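(* Let $E$ be a complete metric space with Borel $\sigma$-field $\mathcal E=\mathcal B(E)$. Let $\mathbb X=(\Omega,\mathcal F,\mathbb P,(\mathcal F_t)_{t\ge0},(X_t)_{t\ge0},E,\mathcal E,(\mathbb P_x)_{x\in E})$ be a $C_{\rm b}$-Feller process and $(T_t)_{t\ge0}$ the associated $C_{\rm b}$-Feller semigroup on $(C_{\rm b}(E),\beta)$ with generator $-A$, where $\beta$ is the strict topology. Assume that the map $X\colon[0,\infty)\times E\to L_0((\Omega,\mathcal F,\mathbb P);E)$, $X(t,x):=X_t$ where $X_0=x$, is continuous. Let $f$ be a Bernstein function. Then $-f(A)$ is the generator of the subordinated semigroup (to $(T_t)_{t\ge0}$ with respect to $f$).
   Context: Markov process: $(X_t)$ is an $E$-valued process on the probability space $(\Omega,\mathcal F,\mathbb P)$ adapted to the filtration $(\mathcal F_t)$, and $(\mathbb P_x)_{x\in E}$ are probability measures on $(\Omega,\mathcal F)$ such that $x\mapsto\mathbb P_x(X_t\in B)$ is measurable for all $t\ge0$, $B\in\mathcal E$ and $\mathbb P_x(X_{t+s}\in B\mid\mathcal F_t)=\mathbb P_{X_t}(X_s\in B)$ $\mathbb P_x$-a.s. for all $x\in E$, $s,t\ge0$, $B\in\mathcal E$. It is normal if $\{x\}\in\mathcal E$ and $\mathbb P_x(X_0=x)=1$ for all $x\in E$. The transition semigroup is $T_tg(x):=\mathbb E_x(g(X_t))$ for bounded measurable $g$, where $\mathbb E_x$ is the expectation with respect to $\mathbb P_x$. A $C_{\rm b}$-Feller process is a normal Markov process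 with $T_t(C_{\rm b}(E))\subseteq C_{\rm b}(E)$ for all $t\ge0$; then $(T_t)$ restricted to $C_{\rm b}(E)$ is the associated $C_{\rm b}$-Feller semigroup. $C_{\rm b}(E)$ is the space of bounded continuous scalar functions on $E$. $L_0((\Omega,\mathcal F,\mathbb P);E)$ is the space of $\mathbb P$-equivalence classes of strongly measurable functions $\Omega\to E$ with the topology of convergence in measure. Strict topology $\beta$ on $C_{\rm b}(E)$: let $\beta E$ be the Stone–Čech compactification of $E$. For compact $Q\subseteq\beta E\setminus E$ let $C_Q(E):=\{g|_E: g\in C(\beta E),\ g|_Q=0\}$ and let $\beta_Q$ be the topology on $C_{\rm b}(E)$ given by the seminorms $h\mapsto\|gh\|_\infty$, $g\in C_Q(E)$. Then $\beta$ is the (locally convex) inductive limit topology of the spaces $(C_{\rm b}(E),\beta_Q)$, $Q\subseteq\beta E\setminus E$ compact. The generator $-A$ of a semigroup $(T_t)_{t\ge0}$ on a locally convex space $Y$ is given by $\mathcal D(A)=\{y\in Y:\lim_{t\to0+}\frac1t(T_ty-y)\text{ exists}\}$, $-Ay=\lim_{t\to0+}\frac1t(T_ty-y)$. A Bernstein function is $f\in C^\infty(0,\infty)$, $f\colon(0,\infty)\to[0,\infty)$, with $(-1)^{k-1}f^{(k)}\ge0$ for all $k\in\{1,2,\dots\}$. For such $f$ there is a unique vaguely continuous family $(\mu_t)_{t\ge0}$ of Radon measures on $[0,\infty)$ with $\mu_t([0,\infty))\le1$, $\mu_0=\delta_0$, $\mu_t*\mu_s=\mu_{t+s}$ and $\int_{[0,\infty)}e^{-\lambda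 s}\mu_t(\mathrm{d}s)=e^{-tf(\lambda)}$ for $\lambda>0$, $t\ge0$. The subordinated semigroup to $(T_t)$ with respect to $f$ is $(S_t)_{t\ge0}$, $S_ty:=\int_{[0,\infty)}T_sy\,\mu_t(\mathrm{d}s)$, the integral being a Pettis integral (i.e. defined by testing against all continuous linear functionals). The generator of $(S_t)$ is denoted by $-A^f$, and one writes $f(A):=A^f$. *)

theory Defs
  imports "HOL-Probability.Probability"
begin

section \<open>Locally convex topologies\<close>

text \<open>The scalar field is a type \<open>'k\<close> of class \<open>{real_normed_field, euclidean_space}\<close>.  By the
  Gelfand--Mazur theorem the only such fields are the real and the complex numbers, so that
  statements about \<open>'k\<close> cover both cases.  The scalar multiplication on the vector space is passed
  explicitly.\<close>

definition seminorm :: "('k::real_normed_field \<Rightarrow> 'y::ab_group_add \<Rightarrow> 'y) \<Rightarrow> ('y \<Rightarrow> real) \<Rightarrow> bool" where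
  "seminorm scl p \<longleftrightarrow>
     (\<forall>y. 0 \<le> p y) \<and> (\<forall>c y. p (scl c y) = norm c * p y) \<and> (\<forall>y z. p (y + z) \<le> p y + p z)"

text \<open>The whole space is added to the subbasis only to cover the empty family.\<close>

definition seminorm_topology :: "('y::ab_group_add \<Rightarrow> real) set \<Rightarrow> 'y topology" where
  "seminorm_topology P =
     topology_generated_by (insert UNIV {{z. p (z - y) < r} | p y r. p \<in> P \<and> 0 < r})"

definition locally_convex ::
    "('k::real_normed_field \<Rightarrow> 'y::ab_group_add \<Rightarrow> 'y) \<Rightarrow> 'y topology \<Rightarrow> bool" where
  "locally_convex scl \<tau> \<longleftrightarrow> (\<exists>P. (\<forall>p\<in>P. seminorm scl p) \<and> \<tau> = seminorm_topology P)"

text \<open>The locally convex inductive limit of a family \<open>\<S>\<close> of topologies on one vector space, with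
  identity maps as linking maps: the finest locally convex topology \<open>\<tau>\<close> for which all identity maps
  from \<open>\<sigma> \<in> \<S>\<close> to \<open>\<tau>\<close> are continuous, obtained as the supremum of all such topologies (see the
  lemmas below).\<close>

definition lc_inductive_limit ::
    "('k::real_normed_field \<Rightarrow> 'y::ab_group_add \<Rightarrow> 'y) \<Rightarrow> 'y topology set \<Rightarrow> 'y topology" where
  "lc_inductive_limit scl \<S> = topology_generated_by
     (\<Union>{{U. openin \<tau> U} | \<tau>. locally_convex scl \<tau> \<and> (\<forall>\<sigma>\<in>\<S>. continuous_map \<sigma> \<tau> id)})"

lemma topspace_seminorm_topology [simp]: "topspace (seminorm_topology P) = UNIV"
  unfolding seminorm_topology_def topology_generated_by_topspace by auto

lemma topology_generated_by_least:
  assumes "\<And>U. U \<in> \<B> \<Longrightarrow> openin \<tau> U" and "openin (topology_generated_by \<B>) V"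
  shows "openin \<tau> V"
proof -
  have "generate_topology_on \<B> V"
    using assms(2) by (simp add: openin_topology_generated_by_iff)
  then show ?thesis
    by induction (auto intro: assms(1))
qed

text \<open>\<^const>\<open>lc_inductive_limit\<close> is itself one of the topologies over which the supremum is taken,
  and it is finer than all of them.\<close>

lemma locally_convex_lc_inductive_limit:
  fixes scl :: "'k::real_normed_field \<Rightarrow> 'y::ab_group_add \<Rightarrow> 'y"
  assumes top: "\<And>\<sigma>. \<sigma> \<in> \<S> \<Longrightarrow> topspace \<sigma> = UNIV"
  shows "locally_convex scl (lc_inductive_limit scl \<S>)"
proof -
  define ok where "ok P \<longleftrightarrow> (\<forall>p\<in>P. seminorm scl p) \<and>
    (\<forall>\<sigma>\<in>\<S>. continuous_map \<sigma> (seminorm_topology P) id)" for P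
  define P where "P = \<Union>{P. ok P}"
  have fam: "{{U. openin \<tau> U} | \<tau>. locally_convex scl \<tau> \<and> (\<forall>\<sigma>\<in>\<S>. continuous_map \<sigma> \<tau> id)}
      = {{U. openin (seminorm_topology P) U} | P. ok P}" (is "?L = ?R")
    unfolding locally_convex_def ok_def by blast
  have lim: "lc_inductive_limit scl \<S> = topology_generated_by (\<Union>?R)"
    unfolding lc_inductive_limit_def fam ..
  have "seminorm_topology {} = topology_generated_by {UNIV :: 'y set}"
    unfolding seminorm_topology_def by (simp del: topology_generated_by_topspace)
  then have ex: "ok {}"
    unfolding ok_def by (auto simp: continuous_on_generated_topo_iff top[symmetric])
  have "lc_inductive_limit scl \<S> = seminorm_topology P"
    unfolding topology_eq
  proof (intro allI iffI)
    fix V assume V: "openin (lc_inductive_limit scl \<S>) V"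
    show "openin (seminorm_topology P) V"
    proof (rule topology_generated_by_least[OF _ V[unfolded lim]])
      fix U assume "U \<in> \<Union>?R"
      then obtain Q where Q: "ok Q" and U: "openin (seminorm_topology Q) U" by blast
      show "openin (seminorm_topology P) U"
      proof (rule topology_generated_by_least[OF _ U[unfolded seminorm_topology_def]])
        fix W assume "W \<in> insert UNIV {{z. p (z - y) < r} | p y r. p \<in> Q \<and> 0 < r}"
        then have "W \<in> insert UNIV {{z. p (z - y) < r} | p y r. p \<in> P \<and> 0 < r}"
          using Q unfolding P_def by blast
        then show "openin (seminorm_topology P) W"
          unfolding seminorm_topology_def by (rule topology_generated_by_Basis)
      qed
    qed
  next
    fix V assume V: "openin (seminorm_topology P) V"
    show "openin (lc_inductive_limit scl \<S>) V"
    proof (rule topology_generated_by_least[OF _ V[unfolded seminorm_topology_def]])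
      fix W assume "W \<in> insert UNIV {{z. p (z - y) < r} | p y r. p \<in> P \<and> 0 < r}"
      then obtain Q where Q: "ok Q" and
          "W \<in> insert UNIV {{z. p (z - y) < r} | p y r. p \<in> Q \<and> 0 < r}"
        using ex unfolding P_def by blast
      then have "openin (seminorm_topology Q) W"
        unfolding seminorm_topology_def by (intro topology_generated_by_Basis)
      then show "openin (lc_inductive_limit scl \<S>) W"
        unfolding lim using Q by (intro topology_generated_by_Basis) blast
    qed
  qed
  moreover have "\<forall>p\<in>P. seminorm scl p"
    unfolding P_def ok_def by blast
  ultimately show ?thesis
    unfolding locally_convex_def by blast
qed

lemma continuous_map_lc_inductive_limit:
  fixes scl :: "'k::real_normed_field \<Rightarrow> 'y::ab_group_add \<Rightarrow> 'y"
  assumes top: "\<And>\<sigma>. \<sigma> \<in> \<S> \<Longrightarrow> topspace \<sigma> = UNIV" and "\<sigma> \<in> \<S>"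
  shows "continuous_map \<sigma> (lc_inductive_limit scl \<S>) id"
proof -
  let ?\<B> = "\<Union>{{U. openin \<tau> U} | \<tau>. locally_convex scl \<tau> \<and> (\<forall>\<sigma>\<in>\<S>. continuous_map \<sigma> \<tau> id)}"
  have "topspace (lc_inductive_limit scl \<S>) = UNIV"
    using locally_convex_lc_inductive_limit[OF top, of \<S> scl] unfolding locally_convex_def by force
  moreover have "openin \<sigma> U" if "U \<in> ?\<B>" for U
    using that \<open>\<sigma> \<in> \<S>\<close> by (force simp: continuous_map_alt top)
  ultimately show ?thesis
    using topology_generated_by_least[of ?\<B> \<sigma>] top[OF \<open>\<sigma> \<in> \<S>\<close>]
    unfolding continuous_map_alt lc_inductive_limit_def by simp
qed

lemma lc_inductive_limit_finest:
  assumes "locally_convex scl \<tau>" "\<And>\<sigma>. \<sigma> \<in> \<S> \<Longrightarrow> continuous_map \<sigma> \<tau> id" "openin \<tau> U"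
  shows "openin (lc_inductive_limit scl \<S>) U"
  unfolding lc_inductive_limit_def using assms by (intro topology_generated_by_Basis) blast


section \<open>Semigroups, generators and Pettis integrals\<close>

definition operator_semigroup ::
    "('k::field \<Rightarrow> 'y::ab_group_add \<Rightarrow> 'y) \<Rightarrow> (real \<Rightarrow> 'y \<Rightarrow> 'y) \<Rightarrow> bool" where
  "operator_semigroup scl T \<longleftrightarrow>
     (\<forall>t\<ge>0. Vector_Spaces.linear scl scl (T t)) \<and> (\<forall>y. T 0 y = y) \<and>
     (\<forall>s\<ge>0. \<forall>t\<ge>0. \<forall>y. T (s + t) y = T s (T t y))"

text \<open>Unbounded operators are represented by their graphs.\<close>

definition generator :: "'y::real_vector topology \<Rightarrow> (real \<Rightarrow> 'y \<Rightarrow> 'y) \<Rightarrow> ('y \<times> 'y) set" where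
  "generator \<tau> T = {(y, z). limitin \<tau> (\<lambda>t. (1 / t) *\<^sub>R (T t y - y)) z (at_right 0)}"

definition op_neg :: "('y::ab_group_add \<times> 'y) set \<Rightarrow> ('y \<times> 'y) set" where
  "op_neg A = {(y, - z) | y z. (y, z) \<in> A}"

definition has_pettis_integral ::
    "('k::{real_normed_field, euclidean_space} \<Rightarrow> 'y::ab_group_add \<Rightarrow> 'y) \<Rightarrow> 'y topology \<Rightarrow>
     'a measure \<Rightarrow> 'a set \<Rightarrow> ('a \<Rightarrow> 'y) \<Rightarrow> 'y \<Rightarrow> bool" where
  "has_pettis_integral scl \<tau> \<mu> S h y \<longleftrightarrow>
     (\<forall>\<phi>. Vector_Spaces.linear scl (*) \<phi> \<and> continuous_map \<tau> euclidean \<phi> \<longrightarrow>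
        set_integrable \<mu> S (\<lambda>s. \<phi> (h s)) \<and> \<phi> y = (LINT s:S|\<mu>. \<phi> (h s)))"


section \<open>Bernstein functions and subordination\<close>

text \<open>Only the values on the open half-line matter.\<close>

definition bernstein_function :: "(real \<Rightarrow> real) \<Rightarrow> bool" where
  "bernstein_function f \<longleftrightarrow>
     (\<forall>x>0. 0 \<le> f x) \<and>
     (\<forall>k. \<forall>x>0. ((deriv ^^ k) f) differentiable (at x)) \<and>
     (\<forall>k\<ge>1. \<forall>x>0. 0 \<le> (-1) ^ (k - 1) * (deriv ^^ k) f x)"

text \<open>Measures on \<open>[0,\<infinity>)\<close> are represented by Borel measures on the line for which the negative
  half-line is a null set; finite Borel measures on the line are automatically Radon.  The test
  functions for vague continuity are the compactly supported continuous functions on \<open>[0,\<infinity>)\<close>.\<close>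

definition bernstein_measures :: "(real \<Rightarrow> real) \<Rightarrow> (real \<Rightarrow> real measure) \<Rightarrow> bool" where
  "bernstein_measures f \<mu> \<longleftrightarrow>
     (\<forall>t\<ge>0. sets (\<mu> t) = sets borel \<and> emeasure (\<mu> t) {..<0} = 0 \<and> emeasure (\<mu> t) {0..} \<le> 1) \<and>
     \<mu> 0 = return borel 0 \<and>
     (\<forall>s\<ge>0. \<forall>t\<ge>0. (\<mu> t \<star> \<mu> s) = \<mu> (t + s)) \<and>
     (\<forall>t\<ge>0. \<forall>l>0. (LINT s:{0..}|\<mu> t. exp (- l * s)) = exp (- t * f l)) \<and>
     (\<forall>\<psi>::real \<Rightarrow> real. continuous_on {0..} \<psi> \<and> (\<exists>r. \<forall>s>r. \<psi> s = 0) \<longrightarrow>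
        continuous_on {0..} (\<lambda>t. LINT s:{0..}|\<mu> t. \<psi> s))"

definition subordinate ::
    "('k::{real_normed_field, euclidean_space} \<Rightarrow> 'y::ab_group_add \<Rightarrow> 'y) \<Rightarrow> 'y topology \<Rightarrow>
     (real \<Rightarrow> real measure) \<Rightarrow> (real \<Rightarrow> 'y \<Rightarrow> 'y) \<Rightarrow> real \<Rightarrow> 'y \<Rightarrow> 'y" where
  "subordinate scl \<tau> \<mu> T t y = (THE z. has_pettis_integral scl \<tau> (\<mu> t) {0..} (\<lambda>s. T s y) z)"

text \<open>The operator \<open>f(A) = A\<^sup>f\<close>, where \<open>- A\<close> is the generator of \<open>T\<close> and \<open>\<mu>\<close> is the family of measures
  belonging to \<open>f\<close>: by definition, \<open>- A\<^sup>f\<close> is the generator of the subordinated semigroup.\<close>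

definition bernstein_op ::
    "('k::{real_normed_field, euclidean_space} \<Rightarrow> 'y::real_vector \<Rightarrow> 'y) \<Rightarrow> 'y topology \<Rightarrow>
     (real \<Rightarrow> real measure) \<Rightarrow> (real \<Rightarrow> 'y \<Rightarrow> 'y) \<Rightarrow> ('y \<times> 'y) set" where
  "bernstein_op scl \<tau> \<mu> T = op_neg (generator \<tau> (subordinate scl \<tau> \<mu> T))"


section \<open>The strict topology\<close>

text \<open>The Stone--Cech compactification is the closure of the image of the evaluation map in the
  product of lines indexed by the bounded continuous real functions.\<close>

definition stone_cech_embed :: "'e::topological_space \<Rightarrow> ('e \<Rightarrow>\<^sub>C real) \<Rightarrow> real" where
  "stone_cech_embed x = (\<lambda>f. apply_bcontfun f x)"

definition stone_cech :: "(('e::topological_space \<Rightarrow>\<^sub>C real) \<Rightarrow> real) set" where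
  "stone_cech = closure (range stone_cech_embed)"

lemma compact_stone_cech: "compact (stone_cech :: (('e::topological_space \<Rightarrow>\<^sub>C real) \<Rightarrow> real) set)"
proof -
  let ?K = "PiE UNIV (\<lambda>f::'e \<Rightarrow>\<^sub>C real. cball (0::real) (norm f))"
  have "compactin (product_topology (\<lambda>f. euclidean) UNIV) ?K"
    by (simp add: compactin_PiE)
  then have K: "compact ?K"
    by (simp add: euclidean_product_topology)
  have "closedin (product_topology (\<lambda>f. euclidean) UNIV) ?K"
    by (simp add: closedin_product_topology del: PiE_UNIV_domain)
  then have "closed ?K"
    by (simp add: euclidean_product_topology)
  moreover have "range stone_cech_embed \<subseteq> ?K"
    by (auto simp: stone_cech_embed_def norm_bounded[where 'b = real, unfolded real_norm_def])
  ultimately have "stone_cech \<subseteq> ?K"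
    unfolding stone_cech_def by (rule closure_minimal[rotated])
  moreover have "closed (stone_cech :: (('e \<Rightarrow>\<^sub>C real) \<Rightarrow> real) set)"
    unfolding stone_cech_def by simp
  ultimately show ?thesis
    using compact_Int_closed[OF K] by (metis inf.absorb2)
qed

lemma continuous_stone_cech_embed: "continuous_on UNIV stone_cech_embed"
  unfolding stone_cech_embed_def by (intro continuous_on_coordinatewise_then_product) simp

lemma stone_cech_extension:
  fixes g :: "'e::topological_space \<Rightarrow>\<^sub>C 'k::euclidean_space"
  obtains G where "continuous_on stone_cech G" "\<And>x. G (stone_cech_embed x) = g x"
proof
  define c where "c b = Bcontfun (\<lambda>x. g x \<bullet> b)" for b
  have c: "apply_bcontfun (c b) x = g x \<bullet> b" for b x
    unfolding c_def
  proof (subst Bcontfun_inverse)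
    have "bounded ((\<lambda>y. y \<bullet> b) ` range g)"
      by (intro bounded_linear_image bounded_linear_inner_left) simp
    then show "(\<lambda>x. g x \<bullet> b) \<in> bcontfun"
      by (auto simp: bcontfun_def image_image intro!: continuous_intros)
  qed simp
  show "continuous_on stone_cech (\<lambda>z. \<Sum>b\<in>Basis. z (c b) *\<^sub>R b)"
    by (intro continuous_on_sum continuous_on_scaleR continuous_on_const
        continuous_on_subset[OF continuous_on_product_coordinates subset_UNIV])
  show "(\<Sum>b\<in>Basis. stone_cech_embed x (c b) *\<^sub>R b) = g x" for x
    by (simp add: stone_cech_embed_def c euclidean_representation)
qed

definition bc_scale ::
    "'k::real_normed_field \<Rightarrow> ('e::topological_space \<Rightarrow>\<^sub>C 'k) \<Rightarrow> ('e \<Rightarrow>\<^sub>C 'k)" where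
  "bc_scale c h = Bcontfun (\<lambda>x. c * h x)"

lemma apply_bc_scale [simp]: "apply_bcontfun (bc_scale c h) x = c * h x"
  unfolding bc_scale_def
proof (subst Bcontfun_inverse)
  have "bounded ((\<lambda>y. c * y) ` range h)"
    by (intro bounded_linear_image bounded_linear_mult_right) simp
  then show "(\<lambda>x. c * h x) \<in> bcontfun"
    by (auto simp: bcontfun_def image_image intro!: continuous_intros)
qed simp

lemma vector_space_bc_scale: "vector_space bc_scale"
  by unfold_locales (auto intro!: bcontfun_eqI simp: algebra_simps)

text \<open>\<open>C_vanishing Q\<close> is the space \<open>C\<^sub>Q(E)\<close> of restrictions to \<open>E\<close> of the continuous functions on the
  Stone--Cech compactification that vanish on \<open>Q\<close>.\<close>

definition C_vanishing ::
    "(('e::topological_space \<Rightarrow>\<^sub>C real) \<Rightarrow> real) set \<Rightarrow> ('e \<Rightarrow> 'k::real_normed_field) set" where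
  "C_vanishing Q =
     {G \<circ> stone_cech_embed | G. continuous_on stone_cech G \<and> (\<forall>q\<in>Q. G q = 0)}"

definition strict_topology_at ::
    "(('e::topological_space \<Rightarrow>\<^sub>C real) \<Rightarrow> real) set \<Rightarrow> ('e \<Rightarrow>\<^sub>C 'k::real_normed_field) topology" where
  "strict_topology_at Q =
     seminorm_topology {(\<lambda>h. SUP x. norm (g x * apply_bcontfun h x)) | g. g \<in> C_vanishing Q}"

definition strict_topology :: "('e::topological_space \<Rightarrow>\<^sub>C 'k::real_normed_field) topology" where
  "strict_topology = lc_inductive_limit bc_scale
     {strict_topology_at Q | Q. compact Q \<and> Q \<subseteq> stone_cech - range stone_cech_embed}"


section \<open>Markov processes\<close>

locale normal_markov_process =
  fixes M :: "'w measure" and F :: "real \<Rightarrow> 'w measure"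
    and X :: "real \<Rightarrow> 'w \<Rightarrow> 'e::metric_space" and P :: "'e \<Rightarrow> 'w measure"
  assumes prob_space_M: "prob_space M"
    and filtration: "0 \<le> t \<Longrightarrow> subalgebra M (F t)"
      "0 \<le> s \<Longrightarrow> s \<le> t \<Longrightarrow> subalgebra (F t) (F s)"
    and adapted: "0 \<le> t \<Longrightarrow> X t \<in> F t \<rightarrow>\<^sub>M borel"
    and prob_space_P: "prob_space (P x)" and sets_P: "sets (P x) = sets M"
    and measurable_P: "0 \<le> t \<Longrightarrow> B \<in> sets borel \<Longrightarrow>
      (\<lambda>x. measure (P x) {w \<in> space M. X t w \<in> B}) \<in> borel_measurable borel"
    and markov: "0 \<le> s \<Longrightarrow> 0 \<le> t \<Longrightarrow> B \<in> sets borel \<Longrightarrow>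
      AE w in P x. real_cond_exp (P x) (F t) (indicator {w \<in> space M. X (t + s) w \<in> B}) w
        = measure (P (X t w)) {w' \<in> space M. X s w' \<in> B}"
    and normal: "measure (P x) {w \<in> space M. X 0 w = x} = 1"

definition transition ::
    "(real \<Rightarrow> 'w \<Rightarrow> 'e) \<Rightarrow> ('e \<Rightarrow> 'w measure) \<Rightarrow> real \<Rightarrow> ('e \<Rightarrow> 'k) \<Rightarrow>
     'e \<Rightarrow> 'k::{banach, second_countable_topology}" where
  "transition X P t g x = (\<integral>w. g (X t w) \<partial>P x)"

definition Cb_feller ::
    "(real \<Rightarrow> ('e::topological_space \<Rightarrow> 'k::metric_space) \<Rightarrow> 'e \<Rightarrow> 'k) \<Rightarrow> bool" where
  "Cb_feller T \<longleftrightarrow> (\<forall>t\<ge>0. T t ` bcontfun \<subseteq> bcontfun)"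

definition Cb_semigroup ::
    "(real \<Rightarrow> ('e::topological_space \<Rightarrow> 'k::metric_space) \<Rightarrow> 'e \<Rightarrow> 'k) \<Rightarrow>
     real \<Rightarrow> ('e \<Rightarrow>\<^sub>C 'k) \<Rightarrow> ('e \<Rightarrow>\<^sub>C 'k)" where
  "Cb_semigroup T t g = Bcontfun (T t (apply_bcontfun g))"

text \<open>\<open>L\<^sub>0\<close> with the topology of convergence in measure.  It is modelled on representatives: open
  sets are saturated under almost sure equality, so a map into \<open>L0_topology M\<close> is continuous iff the
  induced map into the quotient space of equivalence classes is.\<close>

definition L0 :: "'w measure \<Rightarrow> ('w \<Rightarrow> 'e::metric_space) set" where
  "L0 M = {f. \<exists>s::nat \<Rightarrow> 'w \<Rightarrow> 'e. (\<forall>n. simple_function M (s n)) \<and>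
              (\<forall>w\<in>space M. (\<lambda>n. s n w) \<longlonglongrightarrow> f w)}"

definition L0_topology :: "'w measure \<Rightarrow> ('w \<Rightarrow> 'e::metric_space) topology" where
  "L0_topology M = topology (\<lambda>U. U \<subseteq> L0 M \<and>
     (\<forall>f\<in>U. \<exists>\<epsilon>>0. \<forall>g\<in>L0 M. measure M {w \<in> space M. dist (f w) (g w) > \<epsilon>} < \<epsilon> \<longrightarrow> g \<in> U))"

lemma L0_dist_measurable:
  assumes "f \<in> L0 M" "g \<in> L0 M"
  shows "(\<lambda>w. dist (f w) (g w)) \<in> borel_measurable M"
proof -
  obtain s where "\<forall>n. simple_function M (s n)" "\<forall>w\<in>space M. (\<lambda>n. s n w) \<longlonglongrightarrow> f w"
    using assms(1) unfolding L0_def mem_Collect_eq by (elim exE conjE)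
  note s = this(1)[rule_format] this(2)[rule_format]
  obtain t where "\<forall>n. simple_function M (t n)" "\<forall>w\<in>space M. (\<lambda>n. t n w) \<longlonglongrightarrow> g w"
    using assms(2) unfolding L0_def mem_Collect_eq by (elim exE conjE)
  note t = this(1)[rule_format] this(2)[rule_format]
  show ?thesis
  proof (rule borel_measurable_LIMSEQ_metric)
    show "(\<lambda>w. dist (s n w) (t n w)) \<in> borel_measurable M" for n
      by (rule borel_measurable_simple_function,
          rule simple_function_compose2[where h = dist, OF s(1) t(1)])
    show "(\<lambda>n. dist (s n w) (t n w)) \<longlonglongrightarrow> dist (f w) (g w)" if "w \<in> space M" for w
      using that by (intro tendsto_dist s t)
  qed
qed

lemma openin_L0_topology:
  assumes "finite_measure M"
  shows "openin (L0_topology M) U \<longleftrightarrow> U \<subseteq> L0 M \<and>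
    (\<forall>f\<in>U. \<exists>\<epsilon>>0. \<forall>g\<in>L0 M. measure M {w \<in> space M. dist (f w) (g w) > \<epsilon>} < \<epsilon> \<longrightarrow> g \<in> U)"
    (is "_ \<longleftrightarrow> ?open U")
proof -
  interpret finite_measure M by fact
  have Int: "?open (U \<inter> V)" if U: "?open U" and V: "?open V" for U V
  proof (intro conjI ballI)
    fix f assume f: "f \<in> U \<inter> V"
    obtain a where a: "a > 0"
      "\<And>g. g \<in> L0 M \<Longrightarrow> measure M {w \<in> space M. dist (f w) (g w) > a} < a \<Longrightarrow> g \<in> U"
      using U f by blast
    obtain b where b: "b > 0"
      "\<And>g. g \<in> L0 M \<Longrightarrow> measure M {w \<in> space M. dist (f w) (g w) > b} < b \<Longrightarrow> g \<in> V"
      using V f by blast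
    have "g \<in> U \<inter> V"
      if g: "g \<in> L0 M" "measure M {w \<in> space M. dist (f w) (g w) > min a b} < min a b" for g
    proof -
      have [measurable]: "(\<lambda>w. dist (f w) (g w)) \<in> borel_measurable M"
        using f U g(1) by (intro L0_dist_measurable) auto
      have "measure M {w \<in> space M. dist (f w) (g w) > c} < c" if "c \<in> {a, b}" for c
      proof -
        have "measure M {w \<in> space M. dist (f w) (g w) > c}
            \<le> measure M {w \<in> space M. dist (f w) (g w) > min a b}"
          using that by (intro finite_measure_mono) auto
        then show ?thesis using g(2) that by auto
      qed
      then show ?thesis using a b g(1) by auto
    qed
    moreover have "min a b > 0" using a(1) b(1) by simp
    ultimately show "\<exists>\<epsilon>>0. \<forall>g\<in>L0 M. measure M {w \<in> space M. dist (f w) (g w) > \<epsilon>} < \<epsilon> \<longrightarrow> g \<in> U \<inter> V"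
      by blast
  next
    show "U \<inter> V \<subseteq> L0 M" using U by blast
  qed
  have Union: "?open (\<Union>\<U>)" if *: "\<forall>U\<in>\<U>. ?open U" for \<U>
  proof (intro conjI ballI)
    fix f assume "f \<in> \<Union>\<U>"
    then obtain U where U: "U \<in> \<U>" "f \<in> U" by blast
    have "\<forall>f\<in>U. \<exists>\<epsilon>>0. \<forall>g\<in>L0 M. measure M {w \<in> space M. dist (f w) (g w) > \<epsilon>} < \<epsilon> \<longrightarrow> g \<in> U"
      using bspec[OF * U(1)] by (rule conjunct2)
    from bspec[OF this U(2)] obtain \<epsilon> where "\<epsilon> > 0"
      "\<forall>g\<in>L0 M. measure M {w \<in> space M. dist (f w) (g w) > \<epsilon>} < \<epsilon> \<longrightarrow> g \<in> U"
      by (elim exE conjE)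
    then show "\<exists>\<epsilon>>0. \<forall>g\<in>L0 M. measure M {w \<in> space M. dist (f w) (g w) > \<epsilon>} < \<epsilon> \<longrightarrow> g \<in> \<Union>\<U>"
      using UnionI[OF U(1)] by (intro exI[of _ \<epsilon>]) simp
  next
    show "\<Union>\<U> \<subseteq> L0 M" using * by blast
  qed
  have "istopology ?open"
    unfolding istopology_def by (rule conjI; intro allI impI; rule Int Union; assumption)
  then show ?thesis
    unfolding L0_topology_def by (simp add: topology_inverse')
qed

text \<open>\<open>Y t x\<close> is "\<open>X\<^sub>t\<close> where \<open>X\<^sub>0 = x\<close>": a realisation on \<open>M\<close> of the process started at \<open>x\<close>, that is,
  a process with initial value \<open>x\<close> whose law under \<open>M\<close> is the law of \<open>X\<close> under \<open>P x\<close>.\<close>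

definition started_process ::
    "'w measure \<Rightarrow> (real \<Rightarrow> 'w \<Rightarrow> 'e) \<Rightarrow> ('e \<Rightarrow> 'w measure) \<Rightarrow>
     (real \<Rightarrow> 'e::metric_space \<Rightarrow> 'w \<Rightarrow> 'e) \<Rightarrow> bool" where
  "started_process M X P Y \<longleftrightarrow>
     (\<forall>t\<ge>0. \<forall>x. Y t x \<in> L0 M) \<and>
     (\<forall>x. AE w in M. Y 0 x w = x) \<and>
     (\<forall>x. distr M (PiM {0..} (\<lambda>_. borel)) (\<lambda>w. \<lambda>t\<in>{0..}. Y t x w)
        = distr (P x) (PiM {0..} (\<lambda>_. borel)) (\<lambda>w. \<lambda>t\<in>{0..}. X t w))"

end

theory Submission
  imports Defs
begin

text \<open>The generator identity holds by definition of \<open>f(A)\<close>; the substance is that the Pettis integrals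
  exist and that they form a semigroup.  Continuity of \<open>X\<close> into \<open>L\<^sub>0\<close> makes \<open>(s, x) \<mapsto> T\<^sub>s g(x)\<close> jointly
  continuous.  Hence the pointwise integral \<open>\<integral> T\<^sub>s g(x) \<mu>\<^sub>t(ds)\<close> is a limit of Riemann sums whose errors are
  dominated by bounded continuous functions (integrated moduli of oscillation) that decrease to \<open>0\<close>.
  A \<open>\<beta>\<close>-continuous functional \<open>\<phi>\<close> is small on functions dominated by a late member of such a sequence
  \<open>k\<^sub>n\<close>: apply \<open>\<beta>\<^sub>Q\<close>-continuity with \<open>Q\<close> the set in \<open>\<beta>E\<close> where all \<open>k\<^sub>n \<ge> \<delta>\<close>, and Dini's theorem.  So
  \<open>\<phi>\<close> commutes with the integral, and no description of the dual of \<open>C\<^sub>b(E)\<close> is needed.\<close>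


section \<open>Functionals continuous for the strict topology\<close>

text \<open>The obstacle is that an orbit of the semigroup need not be norm continuous: its Riemann
  sums need not converge in norm, and boundedness of \<phi> alone cannot carry the limit. The
  majorants have to be continuous because their extensions to \<open>stone_cech\<close> enter Dini's
  theorem; this is why oscillations are taken over compact windows. The property
  \<open>sigma_smooth\<close> serves a second time. Evaluation at a point after \<open>T t\<close>
  has it, by dominated convergence under \<open>P x\<close>, and this moves \<open>T t\<close>
  through the pointwise integral. The semigroup law then reduces to Fubini's theorem for a scalar
  function and the convolution law of the measures. Uniqueness of the Pettis integral rests on point
  evaluations. They are strictly continuous because each point of \<open>E\<close> lies outside
  every admissible \<open>Q\<close> and can be separated from it by a weight.\<close>

lemma seminorm_topology_nhd:
  assumes P: "\<And>p. p \<in> P \<Longrightarrow> seminorm scl p"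
    and U: "openin (seminorm_topology P) U" and y: "y \<in> U"
  obtains F r where "finite F" "F \<subseteq> P" "r > 0" "\<And>z. (\<And>p. p \<in> F \<Longrightarrow> p (z - y) < r) \<Longrightarrow> z \<in> U"
proof -
  have "generate_topology_on (insert UNIV {{z. p (z - y) < r} | p y r. p \<in> P \<and> 0 < r}) U"
    using U by (simp add: seminorm_topology_def openin_topology_generated_by_iff)
  then have "y \<in> U \<longrightarrow> (\<exists>F r. finite F \<and> F \<subseteq> P \<and> r > 0 \<and> (\<forall>z. (\<forall>p\<in>F. p (z - y) < r) \<longrightarrow> z \<in> U))"
  proof induction
    case Empty
    then show ?case by simp
  next
    case (Int a b)
    show ?case
    proof
      assume "y \<in> a \<inter> b"
      with Int obtain F r G s where *: "finite F" "F \<subseteq> P" "r > 0" "\<forall>z. (\<forall>p\<in>F. p (z - y) < r) \<longrightarrow> z \<in> a"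
        "finite G" "G \<subseteq> P" "s > 0" "\<forall>z. (\<forall>p\<in>G. p (z - y) < s) \<longrightarrow> z \<in> b"
        by blast
      show "\<exists>F r. finite F \<and> F \<subseteq> P \<and> r > 0 \<and> (\<forall>z. (\<forall>p\<in>F. p (z - y) < r) \<longrightarrow> z \<in> a \<inter> b)"
      proof (intro exI[of _ "F \<union> G"] exI[of _ "min r s"] conjI allI impI)
        fix z assume "\<forall>p\<in>F \<union> G. p (z - y) < min r s"
        then show "z \<in> a \<inter> b" using *(4,8) by simp
      qed (use * in auto)
    qed
  next
    case (UN K)
    show ?case
    proof
      assume "y \<in> \<Union>K"
      then obtain k where k: "k \<in> K" "y \<in> k" by blast
      from mp[OF UN.IH[OF k(1)] k(2)] show
        "\<exists>F r. finite F \<and> F \<subseteq> P \<and> r > 0 \<and> (\<forall>z. (\<forall>p\<in>F. p (z - y) < r) \<longrightarrow> z \<in> \<Union>K)"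
        using k(1) by (elim exE conjE, intro exI conjI) auto
    qed
  next
    case (Basis s)
    show ?case
    proof
      assume ys: "y \<in> s"
      from Basis consider "s = UNIV" | p a r where "p \<in> P" "r > 0" "s = {z. p (z - a) < r}"
        by blast
      then show "\<exists>F r. finite F \<and> F \<subseteq> P \<and> r > 0 \<and> (\<forall>z. (\<forall>p\<in>F. p (z - y) < r) \<longrightarrow> z \<in> s)"
      proof cases
        case 1
        then show ?thesis by (intro exI[of _ "{}"] exI[of _ 1]) simp
      next
        case 2
        \<comment> \<open>A subbasic ball may be centred anywhere; recentring it at \<open>y\<close>
          costs \<open>p (y - a)\<close> of the radius, which is less than \<open>r\<close> since
          \<open>y\<close> lies in the ball.\<close>
        have "p (z - a) < r" if "p (z - y) < r - p (y - a)" for z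
        proof -
          have "p ((z - y) + (y - a)) \<le> p (z - y) + p (y - a)"
            using P[OF 2(1)] unfolding seminorm_def by blast
          then show ?thesis using that by simp
        qed
        then show ?thesis
          using ys 2 by (intro exI[of _ "{p}"] exI[of _ "r - p (y - a)"]) auto
      qed
    qed
  qed
  from mp[OF this y] obtain F r where "finite F" "F \<subseteq> P" "r > 0" "\<forall>z. (\<forall>p\<in>F. p (z - y) < r) \<longrightarrow> z \<in> U"
    by (elim exE conjE)
  then show ?thesis by (intro that[of F r]) simp_all
qed

section \<open>Weighted supremum seminorms and functionals bounded by them\<close>

lemma stone_cech_embed_in [simp]: "stone_cech_embed x \<in> stone_cech"
  unfolding stone_cech_def by (rule subsetD[OF closure_subset rangeI])

lemma C_vanishing_bounded:
  assumes "g \<in> C_vanishing Q"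
  shows "bounded (range g)"
proof -
  obtain G where G: "g = G \<circ> stone_cech_embed" "continuous_on stone_cech G"
    using assms unfolding C_vanishing_def by blast
  have "bounded (G ` stone_cech)"
    by (intro compact_imp_bounded compact_continuous_image G compact_stone_cech)
  then show ?thesis
    by (rule bounded_subset) (auto simp: G)
qed

lemma bdd_above_norm_mult:
  fixes h :: "'e::topological_space \<Rightarrow>\<^sub>C 'k::real_normed_field"
  assumes "bounded (range g)"
  shows "bdd_above (range (\<lambda>x. norm (g x * h x)))"
proof -
  obtain B where B: "\<And>x. norm (g x) \<le> B"
    using assms unfolding bounded_iff by blast
  have "norm (g x * h x) \<le> B * norm h" for x
    unfolding norm_mult by (intro mult_mono B norm_bounded order_trans[OF _ B]) auto
  then show ?thesis by (intro bdd_aboveI[of _ "B * norm h"]) auto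
qed

lemma seminorm_weighted_sup:
  fixes g :: "'e::topological_space \<Rightarrow> 'k::real_normed_field"
  assumes g: "bounded (range g)"
  shows "seminorm bc_scale (\<lambda>h. SUP x. norm (g x * apply_bcontfun h x))" (is "seminorm _ ?p")
proof -
  note bdd = bdd_above_norm_mult[OF g]
  have up: "norm (g x * h x) \<le> ?p h" for x and h :: "'e \<Rightarrow>\<^sub>C 'k"
    by (rule cSUP_upper[OF _ bdd]) simp
  \<comment> \<open>Homogeneity follows from this inequality: applied to \<open>inverse c\<close> it
    gives the converse for nonzero \<open>c\<close>.\<close>
  have le: "?p (bc_scale c h) \<le> norm c * ?p h" for c and h :: "'e \<Rightarrow>\<^sub>C 'k"
  proof (rule cSUP_least)
    fix x
    have "norm (g x * bc_scale c h x) = norm c * norm (g x * h x)"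
      by (simp add: norm_mult)
    then show "norm (g x * bc_scale c h x) \<le> norm c * ?p h"
      using up[of x h] by (simp add: mult_left_mono)
  qed simp
  have pos: "0 \<le> ?p h" for h :: "'e \<Rightarrow>\<^sub>C 'k"
    using up[of undefined h] norm_ge_zero order_trans by blast
  have "?p (bc_scale c h) = norm c * ?p h" for c and h :: "'e \<Rightarrow>\<^sub>C 'k"
  proof (cases "c = 0")
    case True
    then show ?thesis using le[of 0 h] pos[of "bc_scale 0 h"] by simp
  next
    case False
    have "bc_scale (inverse c) (bc_scale c h) = h"
      using False by (intro bcontfun_eqI) simp
    then have "?p h \<le> inverse (norm c) * ?p (bc_scale c h)"
      using le[of "inverse c" "bc_scale c h"] by (simp add: norm_inverse)
    then have "norm c * ?p h \<le> ?p (bc_scale c h)"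
      using False by (simp add: field_simps)
    then show ?thesis using le[of c h] by simp
  qed
  moreover have "?p (h + h') \<le> ?p h + ?p h'" for h h' :: "'e \<Rightarrow>\<^sub>C 'k"
  proof (rule cSUP_least)
    fix x
    have "norm (g x * (h + h') x) \<le> norm (g x * h x) + norm (g x * h' x)"
      using norm_triangle_ineq[of "g x * h x" "g x * h' x"] by (simp add: distrib_left)
    then show "norm (g x * (h + h') x) \<le> ?p h + ?p h'"
      using up[of x h] up[of x h'] by linarith
  qed simp
  ultimately show ?thesis
    unfolding seminorm_def using pos by blast
qed

lemma topspace_strict_topology_at [simp]: "topspace (strict_topology_at Q) = UNIV"
  unfolding strict_topology_at_def by simp

lemma topspace_strict_topology [simp]:
  "topspace (strict_topology :: ('e::topological_space \<Rightarrow>\<^sub>C 'k::real_normed_field) topology) = UNIV"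
proof -
  have "locally_convex bc_scale (strict_topology :: ('e \<Rightarrow>\<^sub>C 'k) topology)"
    unfolding strict_topology_def by (rule locally_convex_lc_inductive_limit) auto
  then show ?thesis by (metis locally_convex_def topspace_seminorm_topology)
qed

lemma openin_strict_topology_at:
  fixes U :: "('e::topological_space \<Rightarrow>\<^sub>C 'k::real_normed_field) set"
  assumes "openin strict_topology U" "compact Q" "Q \<subseteq> stone_cech - range stone_cech_embed"
  shows "openin (strict_topology_at Q) U"
proof -
  have "continuous_map (strict_topology_at Q) (strict_topology :: ('e \<Rightarrow>\<^sub>C 'k) topology) id"
    unfolding strict_topology_def
    by (rule continuous_map_lc_inductive_limit) (use assms(2,3) in auto)
  then show ?thesis
    using assms(1) by (simp add: continuous_map_alt)
qed

text \<open>Continuity for the inductive limit implies continuity for each single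
  \<open>strict_topology_at Q\<close>, where a neighbourhood of 0 involves finitely many weights.
  The bound is phrased with pointwise estimates by a positive \<open>c\<close>, so that no division
  by a possibly vanishing seminorm occurs.\<close>

lemma strict_functional_bound:
  fixes \<phi> :: "('e::topological_space \<Rightarrow>\<^sub>C 'k::{real_normed_field, euclidean_space}) \<Rightarrow> 'k"
  assumes lin: "Vector_Spaces.linear bc_scale (*) \<phi>" and cont: "continuous_map strict_topology euclidean \<phi>"
    and Q: "compact Q" "Q \<subseteq> stone_cech - range stone_cech_embed"
  obtains F :: "('e \<Rightarrow> 'k) set" and K where "finite F" "F \<subseteq> C_vanishing Q" "K > 0"
    "\<And>h c. c > 0 \<Longrightarrow> (\<And>g x. g \<in> F \<Longrightarrow> norm (g x * apply_bcontfun h x) \<le> c) \<Longrightarrow> norm (\<phi> h) \<le> K * c"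
proof -
  interpret \<phi>: Vector_Spaces.linear bc_scale "(*)" \<phi> by (rule lin)
  define p where "p g = (\<lambda>h. SUP x. norm (g x * apply_bcontfun h x))" for g :: "'e \<Rightarrow> 'k"
  define U where "U = {h. norm (\<phi> h) < 1}"
  have "openin strict_topology {h \<in> topspace strict_topology. \<phi> h \<in> ball 0 1}"
    using cont by (intro openin_continuous_map_preimage[OF cont]) simp
  then have "openin strict_topology U"
    by (simp add: U_def)
  then have "openin (strict_topology_at Q) U"
    by (rule openin_strict_topology_at[OF _ Q])
  then have op: "openin (seminorm_topology (p ` C_vanishing Q)) U"
    by (simp add: strict_topology_at_def p_def image_def Setcompr_eq_image)
  have sn: "seminorm bc_scale q" if "q \<in> p ` C_vanishing Q" for q
    using that seminorm_weighted_sup[OF C_vanishing_bounded] by (auto simp: p_def)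
  have "0 \<in> U" by (simp add: U_def \<phi>.zero)
  from seminorm_topology_nhd[OF sn op this] obtain F' r where F': "finite F'" "F' \<subseteq> p ` C_vanishing Q"
    and r: "r > 0" "\<And>z. (\<And>q. q \<in> F' \<Longrightarrow> q z < r) \<Longrightarrow> z \<in> U"
    by auto
  obtain F where F: "finite F" "F \<subseteq> C_vanishing Q" "F' = p ` F"
    using finite_subset_image[OF F'] by blast
  show ?thesis
  proof
    show "2 / r > 0" using r by simp
    fix h c assume c: "c > 0" and *: "\<And>g x. g \<in> F \<Longrightarrow> norm (g x * apply_bcontfun h x) \<le> c"
    \<comment> \<open>Chosen so that the weighted bound \<open>c\<close> becomes
      \<open>r / 2\<close> after scaling, strictly inside the neighbourhood; undoing the scaling
      produces the constant \<open>2 / r\<close>.\<close>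
    define a where "a = r / (2 * c)"
    have a: "a > 0" using c r by (simp add: a_def)
    have "bc_scale (of_real a) h \<in> U"
    proof (rule r(2))
      fix q assume "q \<in> F'"
      then obtain g where g: "g \<in> F" "q = p g" using F by blast
      have "p g (bc_scale (of_real a) h) \<le> a * c"
        unfolding p_def
      proof (rule cSUP_least)
        fix x
        have "norm (g x * bc_scale (of_real a) h x) = a * norm (g x * h x)"
          using a by (simp add: norm_mult)
        then show "norm (g x * bc_scale (of_real a) h x) \<le> a * c"
          using *[OF g(1), of x] a by simp
      qed simp
      also have "a * c < r" using c r by (simp add: a_def)
      finally show "q (bc_scale (of_real a) h) < r" by (simp add: g)
    qed
    then have "a * norm (\<phi> h) < 1"
      using a by (simp add: U_def \<phi>.scale norm_mult)
    then show "norm (\<phi> h) \<le> 2 / r * c"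
      using c r by (simp add: a_def field_simps)
  qed (use F in auto)
qed

section \<open>Smallness of strictly continuous functionals under decreasing majorants\<close>

lemma Dini_compact:
  fixes f :: "nat \<Rightarrow> 'a::topological_space \<Rightarrow> real"
  assumes K: "compact K" and cont: "\<And>n. continuous_on K (f n)"
    and dec: "\<And>x m n. x \<in> K \<Longrightarrow> m \<le> n \<Longrightarrow> f n x \<le> f m x"
    and lim: "\<And>x. x \<in> K \<Longrightarrow> \<exists>n. f n x < c"
  obtains n where "\<And>x. x \<in> K \<Longrightarrow> f n x < c"
proof (rule ccontr)
  assume "\<not> thesis"
  with that have ne: "\<exists>x\<in>K. f n x \<ge> c" for n
    by (meson not_le)
  \<comment> \<open>Cantor's intersection theorem: the superlevel sets are closed in
    \<open>K\<close>, nested and, if the claim fails, nonempty; a common point contradicts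
    \<open>lim\<close>.\<close>
  have "(\<Inter>n. {x \<in> K. c \<le> f n x}) \<noteq> {}"
  proof (rule compact_space_imp_nest)
    show "compact_space (top_of_set K)" using K by (simp add: compact_space_subtopology)
    show "closedin (top_of_set K) {x \<in> K. c \<le> f n x}" for n
      using continuous_closedin_preimage[OF cont closed_atLeast, of n c] by (simp add: vimage_def Int_def)
    show "{x \<in> K. c \<le> f n x} \<noteq> {}" for n using ne by blast
    show "decseq (\<lambda>n. {x \<in> K. c \<le> f n x})"
      using dec by (auto simp: decseq_def intro: order_trans)
  qed
  then show False using lim by (force simp: not_le[symmetric])
qed

text \<open>A substitute for representing \<open>\<phi>\<close> by a \<open>\<sigma>\<close>-additive measure: the decreasing majorants \<open>k\<close> are
  continuous, so that Dini's theorem on the Stone--Cech compactification applies to them.\<close>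

definition sigma_smooth :: "(('e::topological_space \<Rightarrow>\<^sub>C 'k::real_normed_field) \<Rightarrow> 'k) \<Rightarrow> bool" where
  "sigma_smooth \<phi> \<longleftrightarrow> Vector_Spaces.linear bc_scale (*) \<phi> \<and>
     (\<exists>C. \<forall>h. norm (\<phi> h) \<le> C * norm h) \<and>
     (\<forall>k :: nat \<Rightarrow> 'e \<Rightarrow>\<^sub>C real. (\<forall>x. decseq (\<lambda>n. k n x) \<and> (\<lambda>n. k n x) \<longlonglongrightarrow> 0) \<longrightarrow>
        (\<forall>\<epsilon>>0. \<exists>n. \<forall>h. (\<forall>x. norm (apply_bcontfun h x) \<le> k n x) \<longrightarrow> norm (\<phi> h) \<le> \<epsilon>))"

text \<open>\<open>a\<close> is the radial retraction of \<open>h\<close> onto the ball of radius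
  \<epsilon> and \<open>b\<close> the excess; \<open>max \<epsilon>\<close> in the denominator keeps
  the quotient continuous at zeros of \<open>h\<close>. A norm bound on a functional controls
  \<open>a\<close>, while \<open>b\<close> vanishes wherever \<open>h\<close> is at most \<epsilon>
  and is left to the weights.\<close>

lemma soft_threshold_decomposition:
  fixes h :: "'e::topological_space \<Rightarrow>\<^sub>C 'k::real_normed_field"
  assumes "\<epsilon> > 0"
  obtains a b where "h = a + b" "norm a \<le> \<epsilon>" "\<And>x. norm (b x) = max 0 (norm (h x) - \<epsilon>)"
proof -
  define a where "a = Bcontfun (\<lambda>x. of_real (\<epsilon> / max \<epsilon> (norm (h x))) * h x)"
  have bd: "norm (of_real (\<epsilon> / max \<epsilon> (norm (h x))) * h x) \<le> \<epsilon>" for x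
    using assms by (auto simp: norm_mult norm_divide max_def field_simps)
  have "(\<lambda>x. of_real (\<epsilon> / max \<epsilon> (norm (h x))) * h x) \<in> bcontfun"
    unfolding bcontfun_def mem_Collect_eq
  proof
    have "max \<epsilon> (norm (h x)) \<noteq> 0" for x using assms by simp
    then show "continuous_on UNIV (\<lambda>x. of_real (\<epsilon> / max \<epsilon> (norm (h x))) * h x)"
      by (intro continuous_intros continuous_on_max) auto
    show "bounded (range (\<lambda>x. of_real (\<epsilon> / max \<epsilon> (norm (h x))) * h x))"
      unfolding bounded_iff using bd by blast
  qed
  then have a: "a x = of_real (\<epsilon> / max \<epsilon> (norm (h x))) * h x" for x
    unfolding a_def by (simp add: Bcontfun_inverse)
  have "norm ((h - a) x) = max 0 (norm (h x) - \<epsilon>)" for x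
  proof -
    have "(h - a) x = of_real (1 - \<epsilon> / max \<epsilon> (norm (h x))) * h x"
      by (simp add: a algebra_simps)
    then have "norm ((h - a) x) = \<bar>1 - \<epsilon> / max \<epsilon> (norm (h x))\<bar> * norm (h x)"
      by (metis norm_mult norm_of_real)
    also have "\<dots> = max 0 (norm (h x) - \<epsilon>)"
      using assms by (auto simp: max_def field_simps abs_if)
    finally show ?thesis .
  qed
  moreover have "norm a \<le> \<epsilon>" using bd by (intro norm_bound) (simp add: a)
  ultimately show ?thesis using that[of a "h - a"] by simp
qed

text \<open>In this model of the compactification, \<open>z k\<close> is the value at
  \<open>z\<close> of the continuous extension of \<open>k\<close>, so a closed condition passes
  from the dense image of \<open>E\<close> to all of \<open>stone_cech\<close>.\<close>

lemma stone_cech_mono: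
  fixes k l :: "'e::topological_space \<Rightarrow>\<^sub>C real"
  assumes "\<And>x. k x \<le> l x" "z \<in> stone_cech"
  shows "z k \<le> z l"
proof -
  have "closed {z :: ('e \<Rightarrow>\<^sub>C real) \<Rightarrow> real. z k \<le> z l}"
    by (intro closed_Collect_le continuous_intros continuous_on_product_coordinates)
  moreover have "range stone_cech_embed \<subseteq> {z. z k \<le> z l}"
    using assms(1) by (auto simp: stone_cech_embed_def)
  ultimately have "stone_cech \<subseteq> {z. z k \<le> z l}"
    unfolding stone_cech_def by (rule closure_minimal[rotated])
  then show ?thesis using assms(2) by blast
qed

lemma sigma_smooth_strict:
  fixes \<phi> :: "('e::topological_space \<Rightarrow>\<^sub>C 'k::{real_normed_field, euclidean_space}) \<Rightarrow> 'k"
  assumes lin: "Vector_Spaces.linear bc_scale (*) \<phi>" and cont: "continuous_map strict_topology euclidean \<phi>"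
  shows "sigma_smooth \<phi>"
proof -
  interpret \<phi>: Vector_Spaces.linear bc_scale "(*)" \<phi> by (rule lin)
  \<comment> \<open>For \<open>Q = {}\<close> the weights obey no vanishing condition and are merely
    bounded, so \<open>strict_functional_bound\<close> turns into a norm estimate.\<close>
  obtain C where C: "C > 0" "\<And>h. norm (\<phi> h) \<le> C * norm h"
  proof -
    obtain F :: "('e \<Rightarrow> 'k) set" and K where F: "finite F" "F \<subseteq> C_vanishing {}" "K > 0"
      "\<And>h c. c > 0 \<Longrightarrow> (\<And>g x. g \<in> F \<Longrightarrow> norm (g x * apply_bcontfun h x) \<le> c) \<Longrightarrow> norm (\<phi> h) \<le> K * c"
      by (rule strict_functional_bound[OF lin cont, of "{}"]) auto
    have "bounded (\<Union>g\<in>F. range g)"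
      using F C_vanishing_bounded by (intro bounded_UN) blast+
    then obtain B where B: "B > 0" "\<And>g x. g \<in> F \<Longrightarrow> norm (g x) \<le> B"
      unfolding bounded_pos by blast
    have "norm (\<phi> h) \<le> K * B * norm h" for h
    proof (cases "h = 0")
      case True
      then show ?thesis by (simp add: \<phi>.zero)
    next
      case False
      have "norm (\<phi> h) \<le> K * (B * norm h)"
      proof (rule F(4))
        show "B * norm h > 0" using B False by simp
        show "norm (g x * h x) \<le> B * norm h" if "g \<in> F" for g x
          unfolding norm_mult using B(2)[OF that] B(1) by (intro mult_mono norm_bounded) auto
      qed
      then show ?thesis by simp
    qed
    then show ?thesis using that[of "K * B"] F(3) B(1) by simp
  qed
  have "\<exists>n. \<forall>h. (\<forall>x. norm (apply_bcontfun h x) \<le> k n x) \<longrightarrow> norm (\<phi> h) \<le> \<epsilon>"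
    if dec: "\<And>x. decseq (\<lambda>n. k n x)" and lim: "\<And>x. (\<lambda>n. k n x) \<longlonglongrightarrow> 0" and \<epsilon>: "\<epsilon> > 0"
    for k :: "nat \<Rightarrow> 'e \<Rightarrow>\<^sub>C real" and \<epsilon> :: real
  proof -
    \<comment> \<open>Half of \<epsilon> is reserved for the part of \<open>h\<close> below
      \<delta>, the other half, through \<open>c\<close> further down, for the excess:
      \<open>C * \<delta> + K * c = \<epsilon>\<close>.\<close>
    define \<delta> where "\<delta> = \<epsilon> / (2 * C)"
    have \<delta>: "\<delta> > 0" using \<epsilon> C by (simp add: \<delta>_def)
    \<comment> \<open>\<open>Q\<close> misses \<open>E\<close> since \<open>k n \<longrightarrow> 0\<close> there, and weights vanishing on \<open>Q\<close> force uniform smallness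
      of \<open>max 0 (k n - \<delta>)\<close>.\<close>
    define Q where "Q = stone_cech \<inter> {z. \<forall>n. \<delta> \<le> z (k n)}"
    have "closed {z :: ('e \<Rightarrow>\<^sub>C real) \<Rightarrow> real. \<forall>n. \<delta> \<le> z (k n)}"
      by (intro closed_Collect_all closed_Collect_le continuous_intros continuous_on_product_coordinates)
    then have Q: "compact Q"
      unfolding Q_def by (intro compact_Int_closed compact_stone_cech)
    have "stone_cech_embed x \<notin> Q" for x
    proof -
      have "\<exists>n. k n x < \<delta>"
        using order_tendstoD(2)[OF lim \<delta>, of x] by (auto simp: eventually_sequentially)
      then show ?thesis by (auto simp: Q_def stone_cech_embed_def not_le)
    qed
    then have "Q \<subseteq> stone_cech - range stone_cech_embed"
      by (auto simp: Q_def)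
    from strict_functional_bound[OF lin cont Q this] obtain F :: "('e \<Rightarrow> 'k) set" and K
      where F: "finite F" "F \<subseteq> C_vanishing Q" "K > 0"
        "\<And>h c. c > 0 \<Longrightarrow> (\<And>g x. g \<in> F \<Longrightarrow> norm (g x * apply_bcontfun h x) \<le> c) \<Longrightarrow> norm (\<phi> h) \<le> K * c"
      by blast
    define c where "c = \<epsilon> / (2 * K)"
    have c: "c > 0" using \<epsilon> F(3) by (simp add: c_def)
    have dec': "z (k n) \<le> z (k m)" if "z \<in> stone_cech" "m \<le> n" for z m n
      by (rule stone_cech_mono[OF decseqD[OF dec that(2)] that(1)])
    have "\<exists>n. \<forall>x. norm (g x) * max 0 (k n x - \<delta>) < c" if g: "g \<in> F" for g
    proof -
      have "g \<in> C_vanishing Q" using F(2) g by blast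
      then obtain G where G: "g = G \<circ> stone_cech_embed" "continuous_on stone_cech G" "\<And>q. q \<in> Q \<Longrightarrow> G q = 0"
        unfolding C_vanishing_def by blast
      obtain n where n: "\<And>z. z \<in> stone_cech \<Longrightarrow> norm (G z) * max 0 (z (k n) - \<delta>) < c"
      proof (rule Dini_compact[OF compact_stone_cech, of "\<lambda>n z. norm (G z) * max 0 (z (k n) - \<delta>)" c])
        show "continuous_on stone_cech (\<lambda>z. norm (G z) * max 0 (z (k n) - \<delta>))" for n
          by (intro continuous_intros G continuous_on_subset[OF continuous_on_product_coordinates] subset_UNIV)
        show "norm (G z) * max 0 (z (k n) - \<delta>) \<le> norm (G z) * max 0 (z (k m) - \<delta>)"
          if "z \<in> stone_cech" "m \<le> n" for z m n
          using dec'[OF that] by (intro mult_left_mono) auto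
        \<comment> \<open>On \<open>Q\<close> the weight vanishes; off \<open>Q\<close> some
          \<open>z (k n)\<close> lies below \<delta>, and then the cut-off factor vanishes.\<close>
        show "\<exists>n. norm (G z) * max 0 (z (k n) - \<delta>) < c" if "z \<in> stone_cech" for z
        proof (cases "z \<in> Q")
          case True
          then show ?thesis using G(3) c by simp
        next
          case False
          then obtain n where "z (k n) < \<delta>" using \<open>z \<in> stone_cech\<close> by (auto simp: Q_def not_le)
          then show ?thesis using c by (intro exI[of _ n]) simp
        qed
      qed blast
      show ?thesis
        using n[OF stone_cech_embed_in] by (intro exI[of _ n]) (simp add: G(1) stone_cech_embed_def)
    qed
    then obtain N where N: "\<And>g x. g \<in> F \<Longrightarrow> norm (g x) * max 0 (k (N g) x - \<delta>) < c"
      by metis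
    \<comment> \<open>One index for all weights: passing to a later index only lowers
      \<open>k n\<close>. Inserting 0 makes \<open>Max\<close> meaningful for empty
      \<open>F\<close>.\<close>
    define n where "n = Max (insert 0 (N ` F))"
    have n: "N g \<le> n" if "g \<in> F" for g
      using F(1) that by (simp add: n_def)
    have "norm (\<phi> h) \<le> \<epsilon>" if h: "\<And>x. norm (h x) \<le> k n x" for h :: "'e \<Rightarrow>\<^sub>C 'k"
    proof -
      obtain a b where ab: "h = a + b" "norm a \<le> \<delta>" "\<And>x. norm (b x) = max 0 (norm (h x) - \<delta>)"
        using soft_threshold_decomposition[OF \<delta>, of h] by blast
      have "norm (\<phi> a) \<le> C * \<delta>"
        using C(2)[of a] mult_left_mono[OF ab(2), of C] C(1) by linarith
      moreover have "norm (\<phi> b) \<le> K * c"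
      proof (rule F(4)[OF c])
        fix g x assume g: "g \<in> F"
        have "norm (h x) \<le> k (N g) x"
          using h[of x] decseqD[OF dec n[OF g], of x] by (rule order_trans)
        then have "norm (g x) * norm (b x) \<le> norm (g x) * max 0 (k (N g) x - \<delta>)"
          unfolding ab(3) by (intro mult_left_mono) auto
        then show "norm (g x * b x) \<le> c"
          using N[OF g, of x] by (simp add: norm_mult)
      qed
      ultimately have "norm (\<phi> h) \<le> C * \<delta> + K * c"
        unfolding ab(1) \<phi>.add by (rule norm_triangle_mono)
      also have "\<dots> = \<epsilon>" using C(1) F(3) by (simp add: \<delta>_def c_def)
      finally show ?thesis .
    qed
    then show ?thesis by (intro exI[of _ n]) simp
  qed
  note main = this
  show ?thesis
    unfolding sigma_smooth_def
  proof (intro conjI lin exI[of _ C] allI impI)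
    show "norm (\<phi> h) \<le> C * norm h" for h by (rule C(2))
    fix k :: "nat \<Rightarrow> 'e \<Rightarrow>\<^sub>C real" and \<epsilon> :: real
    assume "\<forall>x. decseq (\<lambda>n. k n x) \<and> (\<lambda>n. k n x) \<longlonglongrightarrow> 0" "\<epsilon> > 0"
    then show "\<exists>n. \<forall>h. (\<forall>x. norm (apply_bcontfun h x) \<le> k n x) \<longrightarrow> norm (\<phi> h) \<le> \<epsilon>"
      by (intro main) simp_all
  qed
qed

section \<open>Strict continuity of point evaluations\<close>

lemma stone_cech_separation:
  fixes x :: "'e::topological_space"
  assumes "closed Q" "stone_cech_embed x \<notin> Q"
  obtains g :: "'e \<Rightarrow> 'k::real_normed_field" where "g \<in> C_vanishing Q" "g x = 1"
proof -
  \<comment> \<open>Powers of the line are completely regular, so some continuous \<open>f\<close>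
    is 0 at the given point and 1 on \<open>Q\<close>; the weight is \<open>1 - f\<close>.\<close>
  have "completely_regular_space (product_topology (\<lambda>_::'e \<Rightarrow>\<^sub>C real. euclideanreal) UNIV)"
    by (simp add: completely_regular_space_product_topology metrizable_imp_completely_regular_space metrizable_space_euclidean)
  then have "completely_regular_space (euclidean :: (('e \<Rightarrow>\<^sub>C real) \<Rightarrow> real) topology)"
    by (simp add: euclidean_product_topology)
  then obtain f :: "(('e \<Rightarrow>\<^sub>C real) \<Rightarrow> real) \<Rightarrow> real"
    where f: "continuous_map euclidean (top_of_set {0..1}) f" "f (stone_cech_embed x) = 0" "f ` Q \<subseteq> {1}"
    using assms unfolding completely_regular_space_def
    by (elim allE[of _ Q] allE[of _ "stone_cech_embed x"]) (auto simp: closed_closedin[symmetric])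
  then have "continuous_on stone_cech f"
    by (auto simp: continuous_map_in_subtopology intro: continuous_on_subset)
  then have "continuous_on stone_cech (\<lambda>z. of_real (1 - f z) :: 'k)"
    by (intro continuous_intros)
  then have "(\<lambda>z. of_real (1 - f z) :: 'k) \<circ> stone_cech_embed \<in> C_vanishing Q"
    unfolding C_vanishing_def using f(3) by (intro CollectI exI conjI refl) auto
  then show ?thesis using that f(2) by force
qed

lemma linear_eval: "Vector_Spaces.linear bc_scale (*) (\<lambda>h::'e::topological_space \<Rightarrow>\<^sub>C 'k::real_normed_field. apply_bcontfun h x)"
proof -
  interpret vs: vector_space "bc_scale :: 'k \<Rightarrow> ('e \<Rightarrow>\<^sub>C 'k) \<Rightarrow> _" by (rule vector_space_bc_scale)
  show ?thesis by unfold_locales (auto simp: algebra_simps)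
qed

text \<open>A map is continuous for the limit topology as soon as it is continuous for some locally
  convex topology coarser than every \<open>strict_topology_at Q\<close>; here that topology is
  given by the single seminorm of evaluation at \<open>x\<close>. It is coarser because
  \<open>x\<close> lies outside \<open>Q\<close>: some weight has the value 1 at \<open>x\<close>,
  and its seminorm dominates. Point evaluations separate functions, which will make Pettis integrals
  unique.\<close>

lemma continuous_map_strict_topology_eval:
  "continuous_map (strict_topology :: ('e::topological_space \<Rightarrow>\<^sub>C 'k::real_normed_field) topology) euclidean (\<lambda>h. apply_bcontfun h x)"
proof -
  define \<tau> :: "('e \<Rightarrow>\<^sub>C 'k) topology" where "\<tau> = seminorm_topology {\<lambda>h. norm (apply_bcontfun h x)}"
  have lc: "locally_convex bc_scale \<tau>"
    unfolding locally_convex_def \<tau>_def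
    by (intro exI[of _ "{\<lambda>h. norm (apply_bcontfun h x)}"]) (auto simp: seminorm_def norm_mult norm_triangle_ineq)
  have sub: "continuous_map (strict_topology_at Q) \<tau> id"
    if Q: "compact Q" "Q \<subseteq> stone_cech - range stone_cech_embed" for Q
  proof -
    have "Hausdorff_space (product_topology (\<lambda>_::'e \<Rightarrow>\<^sub>C real. euclideanreal) UNIV)"
      by (simp add: Hausdorff_space_product_topology)
    then have "Hausdorff_space (euclidean :: (('e \<Rightarrow>\<^sub>C real) \<Rightarrow> real) topology)"
      by (simp add: euclidean_product_topology)
    then have "closed Q"
      using compactin_imp_closedin[of euclidean Q] Q(1) by simp
    moreover have "stone_cech_embed x \<notin> Q" using Q(2) by blast
    ultimately obtain g :: "'e \<Rightarrow> 'k" where g: "g \<in> C_vanishing Q" "g x = 1"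
      by (rule stone_cech_separation)
    define p where "p = (\<lambda>h::'e \<Rightarrow>\<^sub>C 'k. SUP x. norm (g x * h x))"
    have p: "norm (apply_bcontfun h x) \<le> p h" for h
      using cSUP_upper[OF UNIV_I[of x] bdd_above_norm_mult[OF C_vanishing_bounded[OF g(1)], of h]]
      by (simp add: p_def g(2))
    have p0: "p 0 = 0" by (simp add: p_def)
    have ball: "openin (strict_topology_at Q) {z. norm ((z - y) x) < r}" for y :: "'e \<Rightarrow>\<^sub>C 'k" and r
    proof (subst openin_subopen, intro ballI)
      fix w assume w: "w \<in> {z. norm ((z - y) x) < r}"
      define W where "W = {z. p (z - w) < r - norm ((w - y) x)}"
      have "openin (strict_topology_at Q) W"
        unfolding strict_topology_at_def seminorm_topology_def W_def
      proof (rule topology_generated_by_Basis, rule insertI2, rule CollectI,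
          intro exI[of _ p] exI[of _ w] exI[of _ "r - norm ((w - y) x)"] conjI refl)
        show "p \<in> {\<lambda>h. SUP x. norm (g x * apply_bcontfun h x) | g. g \<in> C_vanishing Q}"
          using g(1) by (auto simp: p_def)
      qed (use w in auto)
      moreover have "w \<in> W" using w by (simp add: W_def p0)
      moreover have "W \<subseteq> {z. norm ((z - y) x) < r}"
      proof
        fix z assume "z \<in> W"
        then have "norm ((z - w) x) + norm ((w - y) x) < r"
          using p[of "z - w"] by (simp add: W_def)
        then show "z \<in> {z. norm ((z - y) x) < r}"
          using norm_triangle_ineq[of "(z - w) x" "(w - y) x"] by simp
      qed
      ultimately show "\<exists>T. openin (strict_topology_at Q) T \<and> w \<in> T \<and> T \<subseteq> {z. norm ((z - y) x) < r}"
        by (intro exI[of _ W] conjI)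
    qed
    have univ: "openin (strict_topology_at Q) (UNIV :: ('e \<Rightarrow>\<^sub>C 'k) set)"
      by (metis openin_topspace topspace_strict_topology_at)
    have "openin (strict_topology_at Q) V" if "openin \<tau> V" for V
      by (rule topology_generated_by_least[OF _ that[unfolded \<tau>_def seminorm_topology_def]])
        (use ball univ in auto)
    then show ?thesis
      by (simp add: continuous_map_alt \<tau>_def)
  qed
  have "openin strict_topology {h. apply_bcontfun h x \<in> V}" if "open V" for V :: "'k set"
    unfolding strict_topology_def
  proof (rule lc_inductive_limit_finest[OF lc])
    show "openin \<tau> {h. apply_bcontfun h x \<in> V}"
    proof (subst openin_subopen, intro ballI)
      fix w assume "w \<in> {h. apply_bcontfun h x \<in> V}"
      then have "w x \<in> V" by simp
      with that obtain r where r: "r > 0" "ball (w x) r \<subseteq> V"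
        by (rule openE)
      have "openin \<tau> {z. norm ((z - w) x) < r}"
        unfolding \<tau>_def seminorm_topology_def by (rule topology_generated_by_Basis) (use r in auto)
      moreover have "{z. norm ((z - w) x) < r} \<subseteq> {h. apply_bcontfun h x \<in> V}"
        using r by (auto simp: subset_iff dist_norm norm_minus_commute)
      ultimately show "\<exists>T. openin \<tau> T \<and> w \<in> T \<and> T \<subseteq> {h. apply_bcontfun h x \<in> V}"
        using r by (intro exI[of _ "{z. norm ((z - w) x) < r}"]) auto
    qed
  qed (use sub in auto)
  then show ?thesis
    by (simp add: continuous_map_alt vimage_def)
qed

section \<open>Integrals of jointly continuous families\<close>

lemma abs_SUP_diff_le:
  fixes f g :: "'a \<Rightarrow> real"
  assumes "C \<noteq> {}" "bdd_above (f ` C)" "bdd_above (g ` C)" "\<And>t. t \<in> C \<Longrightarrow> \<bar>f t - g t\<bar> \<le> e"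
  shows "\<bar>(SUP t\<in>C. f t) - (SUP t\<in>C. g t)\<bar> \<le> e"
proof -
  have "(SUP t\<in>C. f t) \<le> (SUP t\<in>C. g t) + e"
    using assms(1)
  proof (rule cSUP_least)
    fix t assume t: "t \<in> C"
    show "f t \<le> (SUP t\<in>C. g t) + e"
      using assms(4)[OF t] cSUP_upper[OF t assms(3)] by linarith
  qed
  moreover have "(SUP t\<in>C. g t) \<le> (SUP t\<in>C. f t) + e"
    using assms(1)
  proof (rule cSUP_least)
    fix t assume t: "t \<in> C"
    show "g t \<le> (SUP t\<in>C. f t) + e"
      using assms(4)[OF t] cSUP_upper[OF t assms(2)] by linarith
  qed
  ultimately show ?thesis by linarith
qed

text \<open>Compactness of \<open>C\<close> makes \<open>F (y, w)\<close> close to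
  \<open>F (z, w)\<close> uniformly in \<open>w\<close> as \<open>y\<close> tends to
  \<open>z\<close>, and suprema are nonexpansive for the uniform distance.\<close>

lemma continuous_on_SUP_compact:
  fixes F :: "'a::topological_space \<times> 'b::topological_space \<Rightarrow> real"
  assumes cont: "continuous_on (UNIV \<times> C) F" and C: "compact C" "C \<noteq> {}"
  shows "continuous_on UNIV (\<lambda>z. SUP w\<in>C. F (z, w))"
proof -
  have bdd: "bdd_above ((\<lambda>w. F (z, w)) ` C)" for z
    by (intro bounded_imp_bdd_above compact_imp_bounded compact_continuous_image C
        continuous_on_compose2[OF cont] continuous_intros) auto
  have "((\<lambda>z. SUP w\<in>C. F (z, w)) \<longlongrightarrow> (SUP w\<in>C. F (z, w))) (nhds z)" for z
  proof (rule tendstoI)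
    fix e :: real assume e: "e > 0"
    obtain X0 where X0: "z \<in> X0" "open X0"
        "\<forall>x\<in>X0 \<inter> UNIV. \<forall>t\<in>C. dist (F (x, t)) (F (z, t)) \<le> e / 2"
      by (rule continuous_on_prod_compactE[OF cont C(1), of z "e / 2"]) (use e in auto)
    have "dist (SUP w\<in>C. F (y, w)) (SUP w\<in>C. F (z, w)) < e" if "y \<in> X0" for y
    proof -
      have "\<bar>(SUP w\<in>C. F (y, w)) - (SUP w\<in>C. F (z, w))\<bar> \<le> e / 2"
        using X0(3) that by (intro abs_SUP_diff_le C bdd) (auto simp: dist_real_def)
      then show ?thesis using e by (simp add: dist_real_def)
    qed
    then show "\<forall>\<^sub>F y in nhds z. dist (SUP w\<in>C. F (y, w)) (SUP w\<in>C. F (z, w)) < e"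
      using X0 by (auto simp: eventually_nhds)
  qed
  then show ?thesis
    unfolding continuous_on_def by (meson filterlim_at_within_not_equal tendsto_mono at_within_le_nhds)
qed

lemma continuous_on_parametric_integral:
  fixes F :: "'a \<Rightarrow> 'b::metric_space \<Rightarrow> 'c::{banach, second_countable_topology}"
  assumes "finite_measure \<mu>" and meas: "\<And>x. (\<lambda>s. F s x) \<in> borel_measurable \<mu>"
    and cont: "\<And>s. continuous_on UNIV (F s)" and bound: "\<And>s x. norm (F s x) \<le> B"
  shows "continuous_on UNIV (\<lambda>x. \<integral>s. F s x \<partial>\<mu>)"
proof -
  interpret finite_measure \<mu> by fact
  have "(\<lambda>n. \<integral>s. F s (u n) \<partial>\<mu>) \<longlonglongrightarrow> (\<integral>s. F s x \<partial>\<mu>)" if "u \<longlonglongrightarrow> x" for u x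
    using continuous_on_tendsto_compose[OF cont that]
    by (intro integral_dominated_convergence[where w="\<lambda>_. B"] meas AE_I2 bound) auto
  then show ?thesis
    by (auto simp: continuous_on_sequentially o_def)
qed

text \<open>Applied to \<open>grid n\<close> with the integrands \<open>v a x\<close> and
  \<open>\<phi> (v a)\<close>, it produces the same weights in both cases. This is how \<phi>
  commutes with Riemann sums.\<close>

lemma integral_finite_range:
  fixes F :: "'b::t2_space \<Rightarrow> 'c::{banach, second_countable_topology}"
  assumes "finite_measure \<mu>" and q: "q \<in> borel_measurable \<mu>" "finite (range q)"
  shows "(\<integral>s. F (q s) \<partial>\<mu>) = (\<Sum>a\<in>range q. measure \<mu> {s \<in> space \<mu>. q s = a} *\<^sub>R F a)"
proof -
  interpret finite_measure \<mu> by fact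
  have [measurable]: "{s \<in> space \<mu>. q s = a} \<in> sets \<mu>" for a
    using measurable_sets[OF q(1), of "{a}"] by (simp add: vimage_def Int_def conj_commute)
  have "(\<integral>s. F (q s) \<partial>\<mu>) = (\<integral>s. (\<Sum>a\<in>range q. indicator {s \<in> space \<mu>. q s = a} s *\<^sub>R F a) \<partial>\<mu>)"
  proof (rule Bochner_Integration.integral_cong[OF refl])
    fix s assume "s \<in> space \<mu>"
    then have "(\<Sum>a\<in>range q. indicator {s \<in> space \<mu>. q s = a} s *\<^sub>R F a) = (\<Sum>a\<in>range q. if a = q s then F a else 0)"
      by (intro sum.cong) (auto simp: indicator_def)
    then show "F (q s) = (\<Sum>a\<in>range q. indicator {s \<in> space \<mu>. q s = a} s *\<^sub>R F a)"
      using q(2) by simp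
  qed
  also have "\<dots> = (\<Sum>a\<in>range q. measure \<mu> {s \<in> space \<mu>. q s = a} *\<^sub>R F a)"
    by (subst Bochner_Integration.integral_sum) (auto simp: less_top[symmetric])
  finally show ?thesis .
qed

text \<open>Truncated to a finite range: a linear functional only commutes with finite Riemann sums.\<close>

definition grid :: "nat \<Rightarrow> real \<Rightarrow> real" where
  "grid n s = (if \<bar>s\<bar> \<le> real n then of_int \<lfloor>real (Suc n) * s\<rfloor> / real (Suc n) else 0)"

lemma grid_dist:
  assumes "\<bar>s\<bar> \<le> real n"
  shows "\<bar>grid n s - s\<bar> \<le> 1 / real (Suc n)"
proof -
  have "\<bar>of_int \<lfloor>real (Suc n) * s\<rfloor> - real (Suc n) * s\<bar> \<le> 1" by linarith
  moreover have "grid n s - s = (of_int \<lfloor>real (Suc n) * s\<rfloor> - real (Suc n) * s) / real (Suc n)"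
    using assms by (simp add: grid_def field_simps)
  ultimately show ?thesis by (simp add: divide_right_mono)
qed

lemma grid_tendsto: "(\<lambda>n. grid n s) \<longlonglongrightarrow> s"
proof -
  obtain N :: nat where N: "\<bar>s\<bar> \<le> real N" using real_arch_simple by blast
  have "(\<lambda>n. grid n s - s) \<longlonglongrightarrow> 0"
  proof (rule Lim_null_comparison)
    show "\<forall>\<^sub>F n in sequentially. norm (grid n s - s) \<le> 1 / real (Suc n)"
      using N by (auto simp: eventually_sequentially simp del: of_nat_Suc intro!: exI[of _ N] grid_dist)
    show "(\<lambda>n. 1 / real (Suc n)) \<longlonglongrightarrow> 0" by (rule LIMSEQ_Suc[OF lim_1_over_n])
  qed
  then show ?thesis by (simp add: LIM_zero_iff)
qed

lemma finite_range_grid: "finite (range (grid n))"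
proof (rule finite_subset)
  show "range (grid n) \<subseteq> insert 0 ((\<lambda>i. of_int i / real (Suc n)) ` {- int (n * Suc n)..int (n * Suc n)})"
  proof clarify
    fix s assume ne: "grid n s \<notin> (\<lambda>i. of_int i / real (Suc n)) ` {- int (n * Suc n)..int (n * Suc n)}"
    show "grid n s = 0"
    proof (cases "\<bar>s\<bar> \<le> real n")
      case True
      have "\<bar>real (Suc n) * s\<bar> \<le> real (n * Suc n)"
        using mult_left_mono[OF True, of "real (Suc n)"]
        by (simp only: abs_mult of_nat_mult mult.commute abs_of_nat of_nat_0_le_iff)
      then have "\<lfloor>real (Suc n) * s\<rfloor> \<in> {- int (n * Suc n)..int (n * Suc n)}"
        by (simp add: le_floor_iff floor_le_iff del: of_nat_Suc) linarith
      then show ?thesis using ne True by (simp add: grid_def del: of_nat_Suc)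
    qed (simp add: grid_def)
  qed
qed simp

lemma grid_measurable [measurable]: "grid n \<in> borel_measurable borel"
  unfolding grid_def by measurable

lemma bc_scale_of_real: "bc_scale (of_real c) h = c *\<^sub>R h"
  for h :: "'e::topological_space \<Rightarrow>\<^sub>C 'k::real_normed_field"
  by (intro bcontfun_eqI) (simp add: scaleR_conv_of_real)

text \<open>The scalars of \<phi> act through \<open>bc_scale\<close>, but Riemann sums carry real
  weights; \<open>of_real\<close> reconciles the two.\<close>

lemma sigma_smooth_linear:
  assumes "sigma_smooth \<phi>"
  shows "linear \<phi>"
proof -
  interpret Vector_Spaces.linear bc_scale "(*)" \<phi>
    using assms unfolding sigma_smooth_def by blast
  show ?thesis
    by (rule linearI) (simp_all add: add bc_scale_of_real[symmetric] scale scaleR_conv_of_real)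
qed

lemma sigma_smoothD:
  fixes k :: "nat \<Rightarrow> 'e::topological_space \<Rightarrow>\<^sub>C real"
  assumes "sigma_smooth \<phi>" "\<And>x. decseq (\<lambda>n. k n x)" "\<And>x. (\<lambda>n. k n x) \<longlonglongrightarrow> 0" "\<epsilon> > 0"
  obtains n where "\<And>h. (\<And>x. norm (apply_bcontfun h x) \<le> k n x) \<Longrightarrow> norm (\<phi> h) \<le> \<epsilon>"
proof -
  have "\<exists>n. \<forall>h. (\<forall>x. norm (apply_bcontfun h x) \<le> k n x) \<longrightarrow> norm (\<phi> h) \<le> \<epsilon>"
    using assms unfolding sigma_smooth_def by simp
  then show ?thesis using that by blast
qed

text \<open>Models an orbit extended to negative times by its value at 0, so that windows around
  \<open>s\<close> may cross 0.\<close>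

locale bounded_orbit =
  fixes v :: "real \<Rightarrow> 'e::metric_space \<Rightarrow>\<^sub>C 'k::{real_normed_field, euclidean_space}" and B :: real
  assumes cont: "continuous_on UNIV (\<lambda>(s, x). v s x)" and bound: "norm (v s) \<le> B"
begin

lemma bound_apply: "norm (v s x) \<le> B"
  using norm_bounded bound by (rule order_trans)

lemma B_nonneg: "0 \<le> B"
  using bound norm_ge_zero by (rule order_trans[rotated])

lemma cont_compose [continuous_intros]:
  assumes "continuous_on S p" "continuous_on S r"
  shows "continuous_on S (\<lambda>z. v (p z) (r z))"
  using continuous_on_compose2[OF cont continuous_on_Pair[OF assms]] by simp

lemma measurable_orbit [measurable]: "(\<lambda>s. v s x) \<in> borel_measurable borel"
  by (intro borel_measurable_continuous_onI continuous_intros)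

text \<open>Modulus of oscillation at scale \<open>1 / Suc n\<close>, the mesh of
  \<open>grid n\<close>. Rescaling moves the dependence on \<open>n\<close> and \<open>s\<close>
  from the index set into the function, so the supremum runs over a fixed compact interval and is
  continuous in \<open>(s, x)\<close>.\<close>

definition osc :: "nat \<Rightarrow> real \<Rightarrow> 'e \<Rightarrow> real" where
  "osc n s x = (SUP w\<in>{-1..1::real}. norm (v (s + w / real (Suc n)) x - v s x))"

lemma continuous_osc [continuous_intros]:
  assumes "continuous_on S p" "continuous_on S r"
  shows "continuous_on S (\<lambda>z. osc n (p z) (r z))"
proof -
  have "continuous_on UNIV (\<lambda>z. SUP w\<in>{-1..1::real}. (\<lambda>(z, w). norm (v (fst z + w / real (Suc n)) (snd z) - v (fst z) (snd z))) (z, w))"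
    by (rule continuous_on_SUP_compact) (auto simp: case_prod_beta intro!: continuous_intros)
  then have "continuous_on UNIV (\<lambda>z. osc n (fst z) (snd z))"
    by (simp add: osc_def case_prod_beta)
  from continuous_on_compose2[OF this continuous_on_Pair[OF assms]] show ?thesis by simp
qed

lemma bdd_osc: "bdd_above ((\<lambda>w. norm (v (s + w / real (Suc n)) x - v s x)) ` {-1..1::real})"
  by (intro bdd_aboveI2[of _ _ "B + B"] norm_triangle_le_diff add_mono bound_apply)

lemma osc_upper:
  assumes "\<bar>r - s\<bar> \<le> 1 / real (Suc n)"
  shows "norm (v r x - v s x) \<le> osc n s x"
proof -
  define w where "w = (r - s) * real (Suc n)"
  have r: "r = s + w / real (Suc n)" by (simp add: w_def)
  have "\<bar>w\<bar> = \<bar>r - s\<bar> * real (Suc n)" by (simp add: w_def abs_mult)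
  also have "\<dots> \<le> 1" using assms by (simp add: le_divide_eq)
  finally have "\<bar>w\<bar> \<le> 1" .
  then have w: "w \<in> {-1..1}" by auto
  show ?thesis
    unfolding osc_def r by (rule cSUP_upper[OF w bdd_osc])
qed

lemma osc_least:
  assumes "\<And>r. \<bar>r - s\<bar> \<le> 1 / real (Suc n) \<Longrightarrow> norm (v r x - v s x) \<le> c"
  shows "osc n s x \<le> c"
  unfolding osc_def
proof (rule cSUP_least)
  fix w :: real assume "w \<in> {-1..1}"
  then have "\<bar>w\<bar> \<le> 1" by auto
  then show "norm (v (s + w / real (Suc n)) x - v s x) \<le> c"
    by (intro assms) (simp add: abs_divide divide_right_mono del: of_nat_Suc)
qed simp

lemma osc_nonneg: "0 \<le> osc n s x"
  using osc_upper[of s s n x] by simp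

lemma osc_le: "osc n s x \<le> B + B"
  by (intro osc_least norm_triangle_le_diff add_mono bound_apply)

lemma decseq_osc: "decseq (\<lambda>n. osc n s x)"
proof (rule decseq_SucI, rule osc_least, rule osc_upper)
  fix n r assume "\<bar>r - s\<bar> \<le> 1 / real (Suc (Suc n))"
  also have "\<dots> \<le> 1 / real (Suc n)" by (simp add: field_simps)
  finally show "\<bar>r - s\<bar> \<le> 1 / real (Suc n)" .
qed

lemma osc_tendsto: "(\<lambda>n. osc n s x) \<longlonglongrightarrow> 0"
proof (rule LIMSEQ_I)
  fix e :: real assume e: "e > 0"
  have "continuous_on UNIV (\<lambda>r. v r x)" by (intro continuous_intros)
  then have "isCont (\<lambda>r. v r x) s" by (simp add: continuous_on_eq_continuous_at)
  then obtain d where d: "d > 0" "\<And>r. dist r s < d \<Longrightarrow> dist (v r x) (v s x) < e / 2"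
    using e unfolding continuous_at_eps_delta by (metis half_gt_zero)
  obtain N where N: "1 / real (Suc N) < d"
    using nat_approx_posE d(1) by blast
  have "norm (osc n s x - 0) < e" if "n \<ge> N" for n
  proof -
    have "osc n s x \<le> e / 2"
    proof (rule osc_least)
      fix r assume "\<bar>r - s\<bar> \<le> 1 / real (Suc n)"
      also have "\<dots> \<le> 1 / real (Suc N)" using that by (simp add: field_simps)
      finally have "dist r s < d" using N by (simp add: dist_real_def)
      then show "norm (v r x - v s x) \<le> e / 2" using d(2) by (fastforce simp: dist_norm)
    qed
    then show ?thesis using osc_nonneg[of n s x] e by simp
  qed
  then show "\<exists>N. \<forall>n\<ge>N. norm (osc n s x - 0) < e" by blast
qed

text \<open>For fixed \<open>s\<close> the functions \<open>osc n s\<close> are continuous, decrease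
  to 0 and dominate \<open>v r - v s\<close> for \<open>r\<close> near \<open>s\<close>. This
  replaces norm continuity of the orbit and supplies the measurability needed to integrate
  \<open>\<phi> (v s)\<close>.\<close>

lemma sigma_smooth_continuous:
  assumes "sigma_smooth \<phi>"
  shows "continuous_on UNIV (\<lambda>s. \<phi> (v s))"
proof -
  interpret \<phi>: linear \<phi> by (rule sigma_smooth_linear[OF assms])
  have "\<exists>d>0. \<forall>r. dist r s < d \<longrightarrow> dist (\<phi> (v r)) (\<phi> (v s)) < e" if e: "e > 0" for s e
  proof -
    define k where "k n = Bcontfun (osc n s)" for n
    have "continuous_on UNIV (\<lambda>x. osc n s x)" for n
      by (intro continuous_intros)
    moreover have "bounded (range (osc n s))" for n
      unfolding bounded_iff using osc_nonneg osc_le by (intro exI[of _ "B + B"]) auto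
    ultimately have k: "k n x = osc n s x" for n x
      unfolding k_def by (subst Bcontfun_inverse) (auto simp: bcontfun_def)
    obtain n where n: "\<And>h. (\<And>x. norm (apply_bcontfun h x) \<le> k n x) \<Longrightarrow> norm (\<phi> h) \<le> e / 2"
      using sigma_smoothD[OF assms _ _ half_gt_zero[OF e], of k] decseq_osc osc_tendsto by (auto simp: k)
    have "dist (\<phi> (v r)) (\<phi> (v s)) < e" if "dist r s < 1 / real (Suc n)" for r
    proof -
      have "norm (\<phi> (v r - v s)) \<le> e / 2"
        using that by (intro n) (auto simp: k dist_real_def simp del: of_nat_Suc intro!: osc_upper)
      then show ?thesis using e by (simp add: dist_norm \<phi>.diff)
    qed
    then show ?thesis by (intro exI[of _ "1 / real (Suc n)"]) simp
  qed
  then show ?thesis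
    unfolding continuous_on_eq_continuous_at[OF open_UNIV] continuous_at_eps_delta by blast
qed

lemma mean_bcontfun:
  assumes "finite_measure \<mu>" "sets \<mu> = sets borel"
  shows "(\<lambda>x. \<integral>s. v s x \<partial>\<mu>) \<in> bcontfun"
proof -
  interpret finite_measure \<mu> by fact
  have m: "(\<lambda>s. v s x) \<in> borel_measurable \<mu>" for x
    using measurable_orbit by (simp add: measurable_cong_sets[OF assms(2) refl])
  have "norm (\<integral>s. v s x \<partial>\<mu>) \<le> B * measure \<mu> (space \<mu>)" for x
  proof -
    have "norm (\<integral>s. v s x \<partial>\<mu>) \<le> (\<integral>s. B \<partial>\<mu>)"
      by (intro Bochner_Integration.integral_norm_bound_integral integrable_const
          integrable_const_bound[of _ B] AE_I2 bound_apply m)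
    then show ?thesis by (simp add: mult.commute)
  qed
  then have "bounded (range (\<lambda>x. \<integral>s. v s x \<partial>\<mu>))"
    unfolding bounded_iff by blast
  moreover have "continuous_on UNIV (\<lambda>x. \<integral>s. v s x \<partial>\<mu>)"
    by (rule continuous_on_parametric_integral[where B=B]) (auto intro: assms m bound_apply)
  ultimately show ?thesis by (simp add: bcontfun_def)
qed

text \<open>The values of \<phi> at the Riemann sums \<open>H n\<close> have two limits:
  \<open>\<phi> h\<close>, by smallness of \<phi> along the majorants \<open>k n\<close>, and the
  integral of \<open>\<phi> (v s)\<close>, by continuity of that function and dominated
  convergence.\<close>

lemma sigma_smooth_mean:
  assumes \<phi>: "sigma_smooth \<phi>" and \<mu>: "finite_measure \<mu>" "sets \<mu> = sets borel"
    and h: "\<And>x. apply_bcontfun h x = (\<integral>s. v s x \<partial>\<mu>)"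
  shows "integrable \<mu> (\<lambda>s. \<phi> (v s))" "\<phi> h = (\<integral>s. \<phi> (v s) \<partial>\<mu>)"
proof -
  interpret finite_measure \<mu> by fact
  interpret \<phi>: linear \<phi> by (rule sigma_smooth_linear[OF \<phi>])
  have [simp]: "space \<mu> = UNIV" using sets_eq_imp_space_eq[OF \<mu>(2)] by simp
  have borel: "g \<in> borel_measurable \<mu> \<longleftrightarrow> g \<in> borel_measurable borel" for g :: "real \<Rightarrow> 'b::topological_space"
    by (simp add: measurable_cong_sets[OF \<mu>(2) refl])
  obtain C where C: "\<And>h. norm (\<phi> h) \<le> C * norm h"
    using \<phi> unfolding sigma_smooth_def by blast
  \<comment> \<open>\<open>C\<close> is not known to be nonnegative, hence the absolute
    value.\<close>
  define D where "D = \<bar>C\<bar> * B"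
  have D: "norm (\<phi> (v s)) \<le> D" for s
    unfolding D_def using C[of "v s"] bound[of s] by (meson abs_ge_self abs_ge_zero mult_mono norm_ge_zero order_trans)
  have cont_\<phi>: "continuous_on UNIV (\<lambda>s. \<phi> (v s))" by (rule sigma_smooth_continuous[OF \<phi>])
  then have m\<phi> [measurable]: "(\<lambda>s. \<phi> (v s)) \<in> borel_measurable borel"
    by (rule borel_measurable_continuous_onI)
  show "integrable \<mu> (\<lambda>s. \<phi> (v s))"
    by (rule integrable_const_bound[of _ D]) (auto simp: D borel)
  have mosc [measurable]: "(\<lambda>s. osc n s x) \<in> borel_measurable borel" for n x
    by (intro borel_measurable_continuous_onI continuous_intros)
  \<comment> \<open>The second summand absorbs the truncation of \<open>grid n\<close> outside \<open>[-n, n]\<close>.\<close>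
  define w where "w n s x = osc n s x + (B + B) * indicator {s. real n < \<bar>s\<bar>} s" for n s x
  have mw [measurable]: "(\<lambda>s. w n s x) \<in> borel_measurable borel" for n x
    unfolding w_def by measurable
  have w_nonneg: "0 \<le> w n s x" for n s x
    unfolding w_def using osc_nonneg B_nonneg by (intro add_nonneg_nonneg) auto
  \<comment> \<open>\<open>B + B\<close> comes from the oscillation and another \<open>B + B\<close>
    from the truncation term.\<close>
  have w_le: "w n s x \<le> 2 * (B + B)" for n s x
    unfolding w_def using osc_le[of n s x] B_nonneg by (auto simp: indicator_def)
  have w_bound: "norm (w n s x) \<le> 2 * (B + B)" for n s x
    using w_nonneg[of n s x] w_le[of n s x] by simp
  have iw: "integrable \<mu> (\<lambda>s. w n s x)" for n x
    by (rule integrable_const_bound[OF AE_I2[OF w_bound]]) (simp add: borel)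
  have w_dec: "w n s x \<le> w m s x" if "m \<le> n" for m n s x
    unfolding w_def using B_nonneg that
    by (intro add_mono mult_left_mono decseqD[OF decseq_osc]) (auto simp: indicator_def)
  have w_lim: "(\<lambda>n. w n s x) \<longlonglongrightarrow> 0" for s x
  proof -
    obtain N :: nat where N: "\<bar>s\<bar> \<le> real N" using real_arch_simple by blast
    have "\<forall>\<^sub>F n in sequentially. osc n s x = w n s x"
      using N by (auto simp: w_def eventually_sequentially intro!: exI[of _ N])
    then show ?thesis by (rule Lim_transform_eventually[OF osc_tendsto])
  qed
  have w_grid: "norm (v (grid n s) x - v s x) \<le> w n s x" for n s x
  proof (cases "\<bar>s\<bar> \<le> real n")
    case True
    then show ?thesis using osc_upper[OF grid_dist[OF True]] by (simp add: w_def)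
  next
    case False
    then show ?thesis
      using osc_nonneg[of n s x] norm_triangle_le_diff[OF add_mono[OF bound_apply[of "grid n s" x] bound_apply[of s x]]]
      by (simp add: w_def)
  qed
  define k where "k n = Bcontfun (\<lambda>x. \<integral>s. w n s x \<partial>\<mu>)" for n
  \<comment> \<open>Averaging over \<open>s\<close> keeps the majorants continuous in
    \<open>x\<close>: the discontinuous truncation term depends on \<open>s\<close> alone.\<close>
  have k: "k n x = (\<integral>s. w n s x \<partial>\<mu>)" for n x
  proof -
    have "continuous_on UNIV (\<lambda>x. \<integral>s. w n s x \<partial>\<mu>)"
    proof (rule continuous_on_parametric_integral[OF \<mu>(1) _ _ w_bound])
      show "continuous_on UNIV (w n s)" for s
        unfolding w_def by (intro continuous_intros)
    qed (simp add: borel)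
    moreover have "norm (\<integral>s. w n s x \<partial>\<mu>) \<le> (\<integral>s. 2 * (B + B) \<partial>\<mu>)" for x
      by (intro Bochner_Integration.integral_norm_bound_integral iw w_bound integrable_const)
    then have "bounded (range (\<lambda>x. \<integral>s. w n s x \<partial>\<mu>))"
      unfolding bounded_iff by blast
    ultimately show ?thesis
      unfolding k_def by (subst Bcontfun_inverse) (auto simp: bcontfun_def)
  qed
  have k_dec: "decseq (\<lambda>n. k n x)" for x
    unfolding decseq_def k by (intro allI impI integral_mono iw w_dec)
  have k_lim: "(\<lambda>n. k n x) \<longlonglongrightarrow> 0" for x
  proof -
    have "(\<lambda>n. \<integral>s. w n s x \<partial>\<mu>) \<longlonglongrightarrow> (\<integral>s. 0 \<partial>\<mu>)"
      by (intro integral_dominated_convergence[where w="\<lambda>_. 2 * (B + B)"] AE_I2 w_bound w_lim)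
        (auto simp: borel)
    then show ?thesis by (simp add: k)
  qed
  define H where "H n = (\<Sum>a\<in>range (grid n). measure \<mu> {s. grid n s = a} *\<^sub>R v a)" for n
  have H: "H n x = (\<integral>s. v (grid n s) x \<partial>\<mu>)" for n x
  proof -
    have "H n x = (\<Sum>a\<in>range (grid n). measure \<mu> {s. grid n s = a} *\<^sub>R v a x)"
      unfolding H_def by (induction rule: finite_induct[OF finite_range_grid]) simp_all
    then show ?thesis
      using integral_finite_range[OF \<mu>(1) _ finite_range_grid, of n "\<lambda>a. v a x"] by (simp add: borel)
  qed
  have "\<phi> (H n) = (\<Sum>a\<in>range (grid n). measure \<mu> {s. grid n s = a} *\<^sub>R \<phi> (v a))" for n
    unfolding H_def by (simp add: \<phi>.sum \<phi>.scale)
  then have \<phi>H: "\<phi> (H n) = (\<integral>s. \<phi> (v (grid n s)) \<partial>\<mu>)" for n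
    using integral_finite_range[OF \<mu>(1) _ finite_range_grid, of n "\<lambda>a. \<phi> (v a)"] by (simp add: borel)
  have Hh: "norm ((H n - h) x) \<le> k n x" for n x
  proof -
    have "integrable \<mu> (\<lambda>s. v (grid n s) x)" "integrable \<mu> (\<lambda>s. v s x)"
      by (auto intro!: integrable_const_bound[of _ B] simp: bound_apply borel)
    then have "(H n - h) x = (\<integral>s. v (grid n s) x - v s x \<partial>\<mu>)"
      by (simp add: H h)
    also have "norm \<dots> \<le> (\<integral>s. w n s x \<partial>\<mu>)"
      using \<open>integrable \<mu> (\<lambda>s. v (grid n s) x)\<close> \<open>integrable \<mu> (\<lambda>s. v s x)\<close>
      by (intro Bochner_Integration.integral_norm_bound_integral iw w_grid) auto
    finally show ?thesis by (simp add: k)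
  qed
  have "(\<lambda>n. \<phi> (H n)) \<longlonglongrightarrow> \<phi> h"
  proof (rule LIMSEQ_I)
    fix e :: real assume e: "e > 0"
    obtain N where N: "\<And>h. (\<And>x. norm (apply_bcontfun h x) \<le> k N x) \<Longrightarrow> norm (\<phi> h) \<le> e / 2"
      using sigma_smoothD[OF \<phi> k_dec k_lim half_gt_zero[OF e]] by blast
    have "norm (\<phi> (H n) - \<phi> h) < e" if "n \<ge> N" for n
    proof -
      have "norm (\<phi> (H n - h)) \<le> e / 2"
        by (rule N, rule order_trans[OF Hh]) (rule decseqD[OF k_dec that])
      then show ?thesis using e by (simp add: \<phi>.diff)
    qed
    then show "\<exists>N. \<forall>n\<ge>N. norm (\<phi> (H n) - \<phi> h) < e" by blast
  qed
  moreover have "(\<lambda>n. \<phi> (H n)) \<longlonglongrightarrow> (\<integral>s. \<phi> (v s) \<partial>\<mu>)"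
    unfolding \<phi>H
  proof (rule integral_dominated_convergence[where w="\<lambda>_. D"])
    show "AE s in \<mu>. (\<lambda>n. \<phi> (v (grid n s))) \<longlonglongrightarrow> \<phi> (v s)"
      by (intro AE_I2 continuous_on_tendsto_compose[OF cont_\<phi> grid_tendsto]) auto
  qed (auto simp: borel D)
  ultimately show "\<phi> h = (\<integral>s. \<phi> (v s) \<partial>\<mu>)" by (rule LIMSEQ_unique)
qed

end

section \<open>Subordination of contraction semigroups on bounded continuous functions\<close>

lemma AE_nonneg_half_line:
  assumes "sets \<mu> = sets borel" "emeasure \<mu> {..<0::real} = 0"
  shows "AE s in \<mu>. 0 \<le> s"
  by (rule AE_I[OF _ assms(2)]) (auto simp: assms(1))

text \<open>\<open>F\<close> may be arbitrary at negative times, where a semigroup is unspecified.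
  The extension by \<open>max 0\<close> agrees with it on \<open>{0..}\<close>, and \<mu> does not
  see the rest; measurability is accordingly required of the extension.\<close>

lemma set_integral_nonneg_half_line:
  fixes F :: "real \<Rightarrow> 'c::{banach, second_countable_topology}"
  assumes \<mu>: "sets \<mu> = sets borel" "emeasure \<mu> {..<0} = 0"
    and F: "(\<lambda>s. F (max 0 s)) \<in> borel_measurable borel"
  shows "set_integrable \<mu> {0..} F \<longleftrightarrow> integrable \<mu> (\<lambda>s. F (max 0 s))"
    and "(LINT s:{0..}|\<mu>. F s) = (\<integral>s. F (max 0 s) \<partial>\<mu>)"
proof -
  have eq: "(\<lambda>s. indicator {0..} s *\<^sub>R F s) = (\<lambda>s. indicator {0..} s *\<^sub>R F (max 0 s))"
    by (auto simp: indicator_def max_def)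
  have m: "(\<lambda>s. indicator {0..} s *\<^sub>R F (max 0 s)) \<in> borel_measurable \<mu>" "(\<lambda>s. F (max 0 s)) \<in> borel_measurable \<mu>"
    using F by (simp_all add: measurable_cong_sets[OF \<mu>(1) refl])
  have ae: "AE s in \<mu>. indicator {0..} s *\<^sub>R F (max 0 s) = F (max 0 s)"
    using AE_nonneg_half_line[OF \<mu>] by eventually_elim simp
  show "set_integrable \<mu> {0..} F \<longleftrightarrow> integrable \<mu> (\<lambda>s. F (max 0 s))"
    unfolding set_integrable_def eq by (rule integrable_cong_AE[OF m ae])
  show "(LINT s:{0..}|\<mu>. F s) = (\<integral>s. F (max 0 s) \<partial>\<mu>)"
    unfolding set_lebesgue_integral_def eq by (rule integral_cong_AE[OF m ae])
qed

text \<open>The facts about the process that subordination draws on.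
  \<open>sigma_smooth_eval\<close> will move \<open>T t\<close> through an integral;
  \<open>contraction\<close> could not do so, as the approximating sums need not converge in
  norm.\<close>

locale Cb_contraction_semigroup =
  fixes T :: "real \<Rightarrow> ('e::metric_space \<Rightarrow>\<^sub>C 'k::{real_normed_field, euclidean_space}) \<Rightarrow> ('e \<Rightarrow>\<^sub>C 'k)"
  assumes semigroup: "operator_semigroup bc_scale T"
    and contraction: "0 \<le> t \<Longrightarrow> norm (T t g) \<le> norm g"
    and jointly_continuous: "continuous_on ({0..} \<times> UNIV) (\<lambda>(t, x). T t g x)"
    and sigma_smooth_eval: "0 \<le> t \<Longrightarrow> sigma_smooth (\<lambda>g. T t g x)"
begin

lemma bounded_orbit: "bounded_orbit (\<lambda>s. T (max 0 s) g) (norm g)"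
proof
  have "continuous_on UNIV (\<lambda>z. (\<lambda>(t, x). T t g x) (max 0 (fst z), snd z))"
    by (rule continuous_on_compose2[OF jointly_continuous]) (auto intro!: continuous_intros continuous_on_max)
  then show "continuous_on UNIV (\<lambda>(s, x). T (max 0 s) g x)"
    by (simp add: case_prod_beta)
qed (simp add: contraction)

definition mean :: "real measure \<Rightarrow> ('e \<Rightarrow>\<^sub>C 'k) \<Rightarrow> ('e \<Rightarrow>\<^sub>C 'k)" where
  "mean \<mu> g = Bcontfun (\<lambda>x. \<integral>s. T (max 0 s) g x \<partial>\<mu>)"

lemma apply_mean:
  assumes "finite_measure \<mu>" "sets \<mu> = sets borel"
  shows "mean \<mu> g x = (\<integral>s. T (max 0 s) g x \<partial>\<mu>)"
  unfolding mean_def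
  by (simp add: Bcontfun_inverse bounded_orbit.mean_bcontfun[OF bounded_orbit assms])

lemma integrable_orbit:
  assumes "finite_measure \<mu>" "sets \<mu> = sets borel"
  shows "integrable \<mu> (\<lambda>s. T (max 0 s) g x)"
  using bounded_orbit.measurable_orbit[OF bounded_orbit] bounded_orbit.bound_apply[OF bounded_orbit]
  by (intro finite_measure.integrable_const_bound[OF assms(1), of _ "norm g"])
    (auto simp: measurable_cong_sets[OF assms(2) refl])

text \<open>Necessity tests with point evaluations; sufficiency is \<open>sigma_smooth_mean\<close>
  for strictly continuous functionals. The equivalence gives existence and uniqueness at once, and
  with them the value of the definite description in \<open>subordinate\<close>.\<close>

lemma has_pettis_integral_iff_mean:
  assumes \<mu>: "finite_measure \<mu>" "sets \<mu> = sets borel" "emeasure \<mu> {..<0} = 0"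
  shows "has_pettis_integral bc_scale strict_topology \<mu> {0..} (\<lambda>s. T s g) h \<longleftrightarrow> h = mean \<mu> g"
proof
  assume h: "has_pettis_integral bc_scale strict_topology \<mu> {0..} (\<lambda>s. T s g) h"
  show "h = mean \<mu> g"
  proof (rule bcontfun_eqI)
    fix x
    have "h x = (LINT s:{0..}|\<mu>. T s g x)"
      using h[unfolded has_pettis_integral_def, rule_format, of "\<lambda>h. apply_bcontfun h x"]
        linear_eval continuous_map_strict_topology_eval by blast
    also have "\<dots> = (\<integral>s. T (max 0 s) g x \<partial>\<mu>)"
      by (rule set_integral_nonneg_half_line(2)[OF \<mu>(2,3)])
        (rule bounded_orbit.measurable_orbit[OF bounded_orbit])
    finally show "h x = mean \<mu> g x" by (simp add: apply_mean[OF \<mu>(1,2)])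
  qed
next
  assume h: "h = mean \<mu> g"
  show "has_pettis_integral bc_scale strict_topology \<mu> {0..} (\<lambda>s. T s g) h"
    unfolding has_pettis_integral_def
  proof (intro allI impI)
    fix \<phi> :: "('e \<Rightarrow>\<^sub>C 'k) \<Rightarrow> 'k"
    assume "Vector_Spaces.linear bc_scale (*) \<phi> \<and> continuous_map strict_topology euclidean \<phi>"
    then have \<phi>: "sigma_smooth \<phi>" by (blast intro: sigma_smooth_strict)
    have "(\<lambda>s. \<phi> (T (max 0 s) g)) \<in> borel_measurable borel"
      by (rule borel_measurable_continuous_onI[OF bounded_orbit.sigma_smooth_continuous[OF bounded_orbit \<phi>]])
    note half_line = set_integral_nonneg_half_line[OF \<mu>(2,3), of "\<lambda>s. \<phi> (T s g)", OF this]
    have hx: "\<And>x. h x = (\<integral>s. T (max 0 s) g x \<partial>\<mu>)"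
      by (simp add: h apply_mean[OF \<mu>(1,2)])
    show "set_integrable \<mu> {0..} (\<lambda>s. \<phi> (T s g)) \<and> \<phi> h = (LINT s:{0..}|\<mu>. \<phi> (T s g))"
      using bounded_orbit.sigma_smooth_mean[OF bounded_orbit \<phi> \<mu>(1,2) hx] half_line by simp
  qed
qed

lemma subordinate_eq_mean:
  assumes "finite_measure (\<mu> t)" "sets (\<mu> t) = sets borel" "emeasure (\<mu> t) {..<0} = 0"
  shows "subordinate bc_scale strict_topology \<mu> T t g = mean (\<mu> t) g"
  unfolding subordinate_def has_pettis_integral_iff_mean[OF assms] by simp

lemma semigroup_apply: "0 \<le> s \<Longrightarrow> 0 \<le> t \<Longrightarrow> T (s + t) g = T s (T t g)"
  and T_zero: "T 0 g = g"
  and linear_T: "0 \<le> t \<Longrightarrow> Vector_Spaces.linear bc_scale bc_scale (T t)"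
  using semigroup unfolding operator_semigroup_def by blast+

lemma linear_mean:
  assumes \<mu>: "finite_measure \<mu>" "sets \<mu> = sets borel"
  shows "Vector_Spaces.linear bc_scale bc_scale (mean \<mu>)"
proof -
  interpret vs: vector_space "bc_scale :: 'k \<Rightarrow> ('e \<Rightarrow>\<^sub>C 'k) \<Rightarrow> _" by (rule vector_space_bc_scale)
  have "T (max 0 s) (g + h) = T (max 0 s) g + T (max 0 s) h"
    "T (max 0 s) (bc_scale c g) = bc_scale c (T (max 0 s) g)" for s c g h
    using linear_T[of "max 0 s"] by (auto simp: Vector_Spaces.linear_iff)
  note T = this
  show ?thesis
  proof unfold_locales
    show "mean \<mu> (g + h) = mean \<mu> g + mean \<mu> h" for g h
      by (intro bcontfun_eqI) (simp add: apply_mean[OF \<mu>] T integrable_orbit[OF \<mu>])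
    show "mean \<mu> (bc_scale c g) = bc_scale c (mean \<mu> g)" for c g
      by (intro bcontfun_eqI) (simp add: apply_mean[OF \<mu>] T integrable_orbit[OF \<mu>])
  qed
qed

text \<open>Moving \<open>T q\<close> inside the inner mean leaves a scalar function of
  \<open>q + r\<close>; Fubini's theorem and the convolution as image of the product measure under
  addition do the rest.\<close>

lemma mean_mean:
  assumes \<mu>: "finite_measure \<mu>" "sets \<mu> = sets borel" "emeasure \<mu> {..<0} = 0"
    and \<nu>: "finite_measure \<nu>" "sets \<nu> = sets borel" "emeasure \<nu> {..<0} = 0"
  shows "mean \<mu> (mean \<nu> g) = mean (\<mu> \<star> \<nu>) g"
proof (rule bcontfun_eqI)
  fix x
  interpret M: finite_measure \<mu> by fact
  interpret N: finite_measure \<nu> by fact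
  interpret MN: pair_sigma_finite \<mu> \<nu> ..
  interpret PP: finite_measure "\<mu> \<Otimes>\<^sub>M \<nu>" by (rule finite_measure_pair_measure) fact+
  define v where "v s = T (max 0 s) g x" for s
  have [measurable_cong]: "sets \<mu> = sets borel" "sets \<nu> = sets borel" by fact+
  have v [measurable]: "v \<in> borel_measurable borel"
    unfolding v_def by (rule bounded_orbit.measurable_orbit[OF bounded_orbit])
  have v_bound: "norm (v s) \<le> norm g" for s
    unfolding v_def by (rule bounded_orbit.bound_apply[OF bounded_orbit])
  have conv: "finite_measure (\<mu> \<star> \<nu>)" "sets (\<mu> \<star> \<nu>) = sets borel"
    using \<mu> \<nu> by (auto intro: convolution_finite)
  have inner: "T (max 0 q) (mean \<nu> g) x = (\<integral>r. v (max 0 q + max 0 r) \<partial>\<nu>)" for q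
  proof -
    have "T (max 0 q) (mean \<nu> g) x = (\<integral>r. T (max 0 q) (T (max 0 r) g) x \<partial>\<nu>)"
      by (rule bounded_orbit.sigma_smooth_mean(2)[OF bounded_orbit sigma_smooth_eval \<nu>(1,2)])
        (simp_all add: apply_mean[OF \<nu>(1,2)])
    also have "\<dots> = (\<integral>r. v (max 0 q + max 0 r) \<partial>\<nu>)"
      by (intro Bochner_Integration.integral_cong refl) (simp add: v_def semigroup_apply[symmetric])
    finally show ?thesis .
  qed
  have "mean \<mu> (mean \<nu> g) x = (\<integral>q. (\<integral>r. v (max 0 q + max 0 r) \<partial>\<nu>) \<partial>\<mu>)"
    by (simp add: apply_mean[OF \<mu>(1,2)] inner)
  \<comment> \<open>Since \<open>v\<close> itself applies \<open>max 0\<close>, the two integrands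
    can differ only where \<open>q\<close> or \<open>r\<close> is negative, and both measures ignore
    negative values.\<close>
  also have "\<dots> = (\<integral>q. (\<integral>r. v (q + r) \<partial>\<nu>) \<partial>\<mu>)"
  proof (rule integral_cong_AE)
    show "AE q in \<mu>. (\<integral>r. v (max 0 q + max 0 r) \<partial>\<nu>) = (\<integral>r. v (q + r) \<partial>\<nu>)"
      using AE_nonneg_half_line[OF \<mu>(2,3)]
    proof eventually_elim
      case (elim q)
      have "AE r in \<nu>. v (max 0 q + max 0 r) = v (q + r)"
        using AE_nonneg_half_line[OF \<nu>(2,3)] elim by (auto elim!: eventually_mono)
      then show ?case by (intro integral_cong_AE) auto
    qed
  qed measurable
  also have "\<dots> = (\<integral>p. v (fst p + snd p) \<partial>(\<mu> \<Otimes>\<^sub>M \<nu>))"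
  proof -
    have "integrable (\<mu> \<Otimes>\<^sub>M \<nu>) (\<lambda>p. v (fst p + snd p))"
      by (rule PP.integrable_const_bound[of _ "norm g"]) (auto simp: v_bound)
    from MN.integral_fst'[OF this] show ?thesis by simp
  qed
  also have "\<dots> = (\<integral>s. v s \<partial>(\<mu> \<star> \<nu>))"
    unfolding convolution_def by (subst integral_distr) (auto simp: case_prod_beta)
  also have "\<dots> = mean (\<mu> \<star> \<nu>) g x"
    by (simp add: apply_mean[OF conv] v_def)
  finally show "mean \<mu> (mean \<nu> g) x = mean (\<mu> \<star> \<nu>) g x" .
qed

lemma subordinate_semigroup:
  assumes \<mu>: "\<And>t. 0 \<le> t \<Longrightarrow> finite_measure (\<mu> t)" "\<And>t. 0 \<le> t \<Longrightarrow> sets (\<mu> t) = sets borel"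
      "\<And>t. 0 \<le> t \<Longrightarrow> emeasure (\<mu> t) {..<0} = 0"
    and zero: "\<mu> 0 = return borel 0"
    and conv: "\<And>s t. 0 \<le> s \<Longrightarrow> 0 \<le> t \<Longrightarrow> (\<mu> s \<star> \<mu> t) = \<mu> (s + t)"
  shows "operator_semigroup bc_scale (subordinate bc_scale strict_topology \<mu> T)"
proof -
  have eq: "subordinate bc_scale strict_topology \<mu> T t g = mean (\<mu> t) g" if "0 \<le> t" for t g
    by (rule subordinate_eq_mean) (use \<mu> that in auto)
  then have eq': "subordinate bc_scale strict_topology \<mu> T t = mean (\<mu> t)" if "0 \<le> t" for t
    using that by blast
  have "mean (\<mu> 0) g = g" for g
  proof (rule bcontfun_eqI)
    fix x
    have "mean (\<mu> 0) g x = (\<integral>s. T (max 0 s) g x \<partial>return borel 0)"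
      using apply_mean[OF \<mu>(1,2), of 0] zero by simp
    also have "\<dots> = g x"
      by (subst integral_return) (auto simp: T_zero bounded_orbit.measurable_orbit[OF bounded_orbit])
    finally show "mean (\<mu> 0) g x = g x" .
  qed
  moreover have "mean (\<mu> (s + t)) g = mean (\<mu> s) (mean (\<mu> t) g)" if "0 \<le> s" "0 \<le> t" for s t g
    using mean_mean[OF \<mu>(1)[OF that(1)] \<mu>(2)[OF that(1)] \<mu>(3)[OF that(1)] \<mu>(1)[OF that(2)] \<mu>(2)[OF that(2)] \<mu>(3)[OF that(2)]]
      conv[OF that] by simp
  ultimately show ?thesis
    unfolding operator_semigroup_def by (simp add: eq' linear_mean[OF \<mu>(1,2)])
qed

end

section \<open>Transition semigroups of Markov processes\<close>

text \<open>Convergence in measure gives almost everywhere convergence only along subsequences; this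
  leads back to the full sequence.\<close>

lemma LIMSEQ_subsequences:
  fixes a :: "nat \<Rightarrow> 'a::topological_space"
  assumes "\<And>r::nat \<Rightarrow> nat. strict_mono r \<Longrightarrow> \<exists>q::nat \<Rightarrow> nat. strict_mono q \<and> (\<lambda>n. a (r (q n))) \<longlonglongrightarrow> l"
  shows "a \<longlonglongrightarrow> l"
proof (rule topological_tendstoI, rule ccontr)
  fix S assume S: "open S" "l \<in> S" and "\<not> (\<forall>\<^sub>F n in sequentially. a n \<in> S)"
  then have "infinite {n. a n \<notin> S}"
    by (simp add: cofinite_eq_sequentially[symmetric] eventually_cofinite)
  from infinite_enumerate[OF this] obtain r :: "nat \<Rightarrow> nat" where r: "strict_mono r" "\<And>n. a (r n) \<notin> S"
    by auto
  obtain q :: "nat \<Rightarrow> nat" where "(\<lambda>n. a (r (q n))) \<longlonglongrightarrow> l"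
    using assms[OF r(1)] by blast
  from topological_tendstoD[OF this S] r(2) show False by simp
qed

section \<open>Convergence in measure and convergence of integrals\<close>

lemma L0_measurable:
  assumes "f \<in> L0 M"
  shows "f \<in> borel_measurable M"
proof -
  obtain s where s: "\<forall>n. simple_function M (s n)" "\<forall>w\<in>space M. (\<lambda>n. s n w) \<longlonglongrightarrow> f w"
    using assms unfolding L0_def mem_Collect_eq by (elim exE conjE)
  show ?thesis
    by (rule borel_measurable_LIMSEQ_metric[of s]) (use s in \<open>auto intro: borel_measurable_simple_function\<close>)
qed

text \<open>The truncated distance has integral \<open>d\<close>, a pseudometric on
  \<open>L0 M\<close> whose balls are open in \<open>L0_topology M\<close>; the cut at 1 makes the
  integrand integrable. Convergence in \<open>d\<close> is what yields an almost everywhere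
  convergent subsequence.\<close>

lemma limitin_L0_imp_L1:
  assumes M: "finite_measure M" and lim: "limitin (L0_topology M) y z F"
    and y: "\<forall>\<^sub>F n in F. y n \<in> L0 M"
  shows "((\<lambda>n. \<integral>w. min 1 (dist (z w) (y n w)) \<partial>M) \<longlongrightarrow> 0) F"
proof -
  interpret finite_measure M by fact
  define d where "d f g = (\<integral>w. min 1 (dist (f w) (g w)) \<partial>M)" for f g :: "'a \<Rightarrow> 'b"
  \<comment> \<open>Where the distance is at most \<delta> the integral contributes at most \<delta>
    times the total mass; the exceptional set adds its mass, which is below \<delta>. Together this
    is at most \<open>\<delta> * L\<close>.\<close>
  define L where "L = measure M (space M) + 1"
  have int: "integrable M (\<lambda>w. min 1 (dist (f w) (g w)))" if "f \<in> L0 M" "g \<in> L0 M" for f g :: "'a \<Rightarrow> 'b"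
    using L0_dist_measurable[OF that] by (intro integrable_const_bound[of _ 1]) auto
  have d_triangle: "d f h \<le> d f g + d g h" if "f \<in> L0 M" "g \<in> L0 M" "h \<in> L0 M" for f g h
  proof -
    have "d f h \<le> (\<integral>w. min 1 (dist (f w) (g w)) + min 1 (dist (g w) (h w)) \<partial>M)"
      unfolding d_def
    proof (intro integral_mono Bochner_Integration.integrable_add int that)
      show "min 1 (dist (f w) (h w)) \<le> min 1 (dist (f w) (g w)) + min 1 (dist (g w) (h w))" for w
        using dist_triangle[of "f w" "h w" "g w"] zero_le_dist[of "f w" "g w"] zero_le_dist[of "g w" "h w"]
        by linarith
    qed
    then show ?thesis by (simp add: d_def int that)
  qed
  have d_small: "d g h \<le> \<delta> * L"
    if "g \<in> L0 M" "h \<in> L0 M" "\<delta> > 0" "measure M {w \<in> space M. dist (g w) (h w) > \<delta>} < \<delta>" for g h \<delta>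
  proof -
    have [measurable]: "(\<lambda>w. dist (g w) (h w)) \<in> borel_measurable M"
      by (rule L0_dist_measurable[OF that(1,2)])
    define A where "A = {w \<in> space M. dist (g w) (h w) > \<delta>}"
    have A [measurable]: "A \<in> sets M" unfolding A_def by measurable
    have iA: "integrable M (indicator A :: _ \<Rightarrow> real)"
      by (simp add: less_top[symmetric])
    have "d g h \<le> (\<integral>w. \<delta> + indicator A w \<partial>M)"
      unfolding d_def using \<open>\<delta> > 0\<close>
      by (intro integral_mono int that Bochner_Integration.integrable_add iA integrable_const)
        (auto simp: A_def indicator_def min_def)
    also have "\<dots> = \<delta> * (L - 1) + measure M A"
      using iA sets.sets_into_space[OF A] by (simp add: L_def mult.commute Int_absorb2)
    also have "\<dots> \<le> \<delta> * L" using that(4) by (simp add: A_def right_diff_distrib)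
    finally show ?thesis .
  qed
  have z: "z \<in> L0 M"
    using limitin_topspace[OF lim] openin_topspace[of "L0_topology M"]
    unfolding openin_L0_topology[OF M] by blast
  have "d z z = 0" by (simp add: d_def)
  have "\<forall>\<^sub>F n in F. d z (y n) < e" if e: "e > 0" for e
  proof -
    define U where "U = {g \<in> L0 M. d z g < e}"
    have "openin (L0_topology M) U"
      unfolding openin_L0_topology[OF M]
    proof (intro conjI ballI)
      fix g assume g: "g \<in> U"
      have L: "L > 0" by (simp add: L_def add_nonneg_pos)
      \<comment> \<open>Makes \<open>\<delta> * L\<close> half of the gap \<open>e - d z g\<close>,
        so the triangle inequality keeps \<open>h\<close> in \<open>U\<close>.\<close>
      define \<delta> where "\<delta> = (e - d z g) / (2 * L)"
      have "\<delta> * L = (e - d z g) / 2" using L by (simp add: \<delta>_def)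
      then have \<delta>: "\<delta> > 0" "\<delta> * L < e - d z g"
        using g L by (simp_all add: \<delta>_def U_def)
      show "\<exists>\<delta>>0. \<forall>h\<in>L0 M. measure M {w \<in> space M. dist (g w) (h w) > \<delta>} < \<delta> \<longrightarrow> h \<in> U"
      proof (intro exI[of _ \<delta>] conjI ballI impI \<delta>(1))
        fix h assume h: "h \<in> L0 M" "measure M {w \<in> space M. dist (g w) (h w) > \<delta>} < \<delta>"
        have "d z h \<le> d z g + d g h" using g h z by (intro d_triangle) (auto simp: U_def)
        also have "d g h \<le> \<delta> * L" using g h \<delta>(1) by (intro d_small) (auto simp: U_def)
        finally show "h \<in> U" using h \<delta>(2) by (simp add: U_def)
      qed
    qed (auto simp: U_def)
    moreover have "z \<in> U" using z e \<open>d z z = 0\<close> by (simp add: U_def)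
    ultimately have "\<forall>\<^sub>F n in F. y n \<in> U"
      using lim unfolding limitin_def by blast
    then show ?thesis by eventually_elim (simp add: U_def)
  qed
  moreover have "d z g \<ge> 0" for g unfolding d_def by (intro integral_nonneg_AE) auto
  ultimately show ?thesis
    unfolding d_def[symmetric] by (intro tendstoI) (simp add: dist_real_def)
qed

text \<open>Every subsequence has a further one along which \<open>y n\<close> converges almost
  everywhere; there continuity of \<open>g\<close> and the dominating constant \<open>norm g\<close>
  suffice.\<close>

lemma limitin_L0_integral:
  fixes g :: "'e::metric_space \<Rightarrow>\<^sub>C 'k::{banach, second_countable_topology}"
  assumes M: "finite_measure M" and lim: "limitin (L0_topology M) y z sequentially"
    and y: "\<And>n. y n \<in> L0 M"
  shows "(\<lambda>n. \<integral>w. g (y n w) \<partial>M) \<longlonglongrightarrow> (\<integral>w. g (z w) \<partial>M)"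
proof (rule LIMSEQ_subsequences)
  fix r :: "nat \<Rightarrow> nat" assume r: "strict_mono r"
  interpret finite_measure M by fact
  have z: "z \<in> L0 M"
    using limitin_topspace[OF lim] openin_topspace[of "L0_topology M"]
    unfolding openin_L0_topology[OF M] by blast
  define u where "u n w = min 1 (dist (z w) (y n w))" for n w
  have "integrable M (u n)" for n
    unfolding u_def using L0_dist_measurable[OF z y[of n]] by (intro integrable_const_bound[of _ 1]) auto
  moreover have "norm (u n w) = u n w" for n w by (simp add: u_def)
  then have "(\<lambda>n. \<integral>w. norm (u n w) \<partial>M) \<longlonglongrightarrow> 0"
    using limitin_L0_imp_L1[OF M lim always_eventually[OF allI[OF y]]] by (simp only: u_def)
  from LIMSEQ_subseq_LIMSEQ[OF this r] have "(\<lambda>n. \<integral>w. norm (u (r n) w) \<partial>M) \<longlonglongrightarrow> 0"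
    by (simp add: o_def)
  ultimately obtain q :: "nat \<Rightarrow> nat" where q: "strict_mono q" "AE w in M. (\<lambda>n. u (r (q n)) w) \<longlonglongrightarrow> 0"
    using tendsto_L1_AE_subseq[of M "\<lambda>n. u (r n)"] by blast
  have "(\<lambda>n. \<integral>w. g (y (r (q n)) w) \<partial>M) \<longlonglongrightarrow> (\<integral>w. g (z w) \<partial>M)"
  proof (rule integral_dominated_convergence[where w="\<lambda>_. norm g"])
    have g: "apply_bcontfun g \<in> borel_measurable borel" by (intro borel_measurable_continuous_onI) simp
    show "(\<lambda>w. g (z w)) \<in> borel_measurable M" "(\<lambda>w. g (y (r (q n)) w)) \<in> borel_measurable M" for n
      using measurable_compose[OF L0_measurable g] z y by blast+
    show "AE w in M. (\<lambda>n. g (y (r (q n)) w)) \<longlonglongrightarrow> g (z w)"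
      using q(2)
    proof eventually_elim
      case (elim w)
      \<comment> \<open>Once it is below 1, the truncated distance is the distance itself.\<close>
      have "\<forall>\<^sub>F n in sequentially. u (r (q n)) w = dist (z w) (y (r (q n)) w)"
        using order_tendstoD(2)[OF elim, of 1] by (auto simp: u_def min_def elim!: eventually_mono split: if_splits)
      from Lim_transform_eventually[OF elim this] have "(\<lambda>n. y (r (q n)) w) \<longlonglongrightarrow> z w"
        by (subst tendsto_dist_iff) (simp add: dist_commute)
      then show ?case
        by (intro continuous_on_tendsto_compose[OF continuous_on_apply_bcontfun[of UNIV g]]) auto
    qed
  qed (auto simp: norm_bounded)
  then show "\<exists>q::nat \<Rightarrow> nat. strict_mono q \<and> (\<lambda>n. \<integral>w. g (y (r (q n)) w) \<partial>M) \<longlonglongrightarrow> (\<integral>w. g (z w) \<partial>M)"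
    using q(1) by blast
qed

text \<open>The real-valued rule \<open>integral_bind\<close> is applied to each coordinate. Inner
  products with basis vectors pass through integrals of integrable functions, which is why most of
  the proof establishes integrability.\<close>

lemma integral_bind_bcontfun:
  fixes g :: "'e::metric_space \<Rightarrow>\<^sub>C 'k::euclidean_space"
  assumes N: "finite_measure N" and K: "K \<in> N \<rightarrow>\<^sub>M subprob_algebra borel" and ne: "space N \<noteq> {}"
  shows "(\<integral>y. g y \<partial>(N \<bind> K)) = (\<integral>x. (\<integral>y. g y \<partial>K x) \<partial>N)"
proof (rule euclidean_eqI)
  fix b :: 'k assume b: "b \<in> Basis"
  interpret N: finite_measure N by fact
  have g [measurable]: "apply_bcontfun g \<in> borel_measurable borel" by (intro borel_measurable_continuous_onI) simp
  have sub: "subprob_space (K x)" "sets (K x) = sets borel" if "x \<in> space N" for x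
    using measurable_space[OF K that] by (auto simp: space_subprob_algebra)
  have intK: "integrable (K x) (\<lambda>y. g y)" if "x \<in> space N" for x
  proof -
    interpret subprob_space "K x" by (rule sub[OF that])
    show ?thesis
      using g by (intro integrable_const_bound[of _ "norm g"]) (auto simp: norm_bounded measurable_cong_sets[OF sub(2)[OF that] refl])
  qed
  have K1: "emeasure (K x) (space (K x)) \<le> ennreal 1" if "x \<in> space N" for x
    using subprob_space.emeasure_space_le_1[OF sub(1)[OF that]] by simp
  have norm_K: "norm (\<integral>y. g y \<partial>K x) \<le> norm g" if x: "x \<in> space N" for x
  proof -
    interpret subprob_space "K x" by (rule sub[OF that])
    have "norm (\<integral>y. g y \<partial>K x) \<le> (\<integral>y. norm (g y) \<partial>K x)" by (rule integral_norm_bound)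
    also have "\<dots> \<le> (\<integral>y. norm g \<partial>K x)"
      by (intro integral_mono integrable_norm intK x integrable_const norm_bounded)
    also have "\<dots> \<le> norm g" using subprob_measure_le_1[of "space (K x)"] by (simp add: mult_left_le_one_le)
    finally show ?thesis .
  qed
  have sets_bind: "sets (N \<bind> K) = sets borel" by (rule sets_bind[OF _ ne]) (use sub in auto)
  interpret NK: finite_measure "N \<bind> K"
  proof
    have "emeasure (N \<bind> K) (space (N \<bind> K)) = (\<integral>\<^sup>+x. emeasure (K x) (space (N \<bind> K)) \<partial>N)"
      by (rule emeasure_bind[OF ne K]) (simp add: sets_bind[symmetric])
    also have "\<dots> \<le> (\<integral>\<^sup>+x. 1 \<partial>N)"
      by (intro nn_integral_mono subprob_space.subprob_emeasure_le_1 sub)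
    finally show "emeasure (N \<bind> K) (space (N \<bind> K)) \<noteq> \<infinity>"
      by (simp add: top_unique N.emeasure_finite) (metis N.emeasure_finite infinity_ennreal_def top_unique)
  qed
  have intNK: "integrable (N \<bind> K) (\<lambda>y. g y)"
    using g by (intro NK.integrable_const_bound[of _ "norm g"]) (auto simp: norm_bounded measurable_cong_sets[OF sets_bind refl])
  have mK: "(\<lambda>x. \<integral>y. g y \<partial>K x) \<in> borel_measurable N"
    by (rule measurable_compose[OF K]) measurable
  have intN: "integrable N (\<lambda>x. \<integral>y. g y \<partial>K x)"
    by (rule N.integrable_const_bound[of _ "norm g"]) (auto simp: norm_K mK)
  have "(\<integral>y. g y \<partial>(N \<bind> K)) \<bullet> b = (\<integral>y. g y \<bullet> b \<partial>(N \<bind> K))"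
    using intNK by simp
  also have "\<dots> = (\<integral>x. (\<integral>y. g y \<bullet> b \<partial>K x) \<partial>N)"
  proof (rule integral_bind[OF _ _ K N])
    show "\<bar>g y \<bullet> b\<bar> \<le> norm g" for y
      using Basis_le_norm[OF b, of "g y"] norm_bounded[of g y] by linarith
    show "AE x in N. emeasure (K x) (space (K x)) \<le> ennreal 1" using K1 by (rule AE_I2)
  qed measurable
  also have "\<dots> = (\<integral>x. (\<integral>y. g y \<partial>K x) \<bullet> b \<partial>N)"
    by (intro Bochner_Integration.integral_cong refl) (simp add: intK)
  also have "\<dots> = (\<integral>x. (\<integral>y. g y \<partial>K x) \<partial>N) \<bullet> b" using intN by simp
  finally show "(\<integral>y. g y \<partial>(N \<bind> K)) \<bullet> b = (\<integral>x. (\<integral>y. g y \<partial>K x) \<partial>N) \<bullet> b" .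
qed

section \<open>The Chapman-Kolmogorov equation and joint continuity of transitions\<close>

context normal_markov_process
begin

lemma measurable_X [measurable]: "0 \<le> t \<Longrightarrow> X t \<in> borel_measurable (P x)"
  using measurable_from_subalg[OF filtration(1) adapted] measurable_cong_sets[OF sets_P refl] by blast

lemma space_P: "space (P x) = space M"
  using sets_P by (rule sets_eq_imp_space_eq)

lemma measurable_bcontfun: "apply_bcontfun (g :: 'e \<Rightarrow>\<^sub>C 'k::real_normed_vector) \<in> borel_measurable borel"
  by (intro borel_measurable_continuous_onI) simp

lemma integrable_bcontfun:
  fixes g :: "'e \<Rightarrow>\<^sub>C 'k::{banach, second_countable_topology}"
  assumes "0 \<le> t"
  shows "integrable (P x) (\<lambda>w. g (X t w))"
proof -
  interpret prob_space "P x" by (rule prob_space_P)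
  show ?thesis
    using measurable_compose[OF measurable_X[OF assms] measurable_bcontfun]
    by (intro integrable_const_bound[of _ "norm g"]) (auto simp: norm_bounded)
qed

text \<open>The Markov property concerns sets, so it is first turned into an identity of laws: under
  \<open>P x\<close>, the law of \<open>X (t + s)\<close> is the law of \<open>X t\<close> followed
  by the kernel \<open>K\<close>. On a set this is the expectation of both sides of the Markov
  property, since conditional expectation preserves the mean.\<close>

lemma Chapman_Kolmogorov:
  fixes g :: "'e \<Rightarrow>\<^sub>C 'k::euclidean_space"
  assumes s: "0 \<le> s" and t: "0 \<le> t"
  shows "transition X P (t + s) g x = transition X P t (transition X P s g) x"
proof -
  interpret prob_space "P x" by (rule prob_space_P)
  define K where "K y = distr (P y) borel (X s)" for y
  have K_emeasure: "emeasure (K y) B = ennreal (measure (P y) {w \<in> space M. X s w \<in> B})" if "B \<in> sets borel" for y B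
  proof -
    interpret y: prob_space "P y" by (rule prob_space_P)
    show ?thesis
      unfolding K_def using that measurable_X[OF s]
      by (simp add: emeasure_distr y.emeasure_eq_measure vimage_def Int_def space_P conj_commute)
  qed
  have K: "K \<in> borel \<rightarrow>\<^sub>M subprob_algebra borel"
  proof (rule measurable_subprob_algebra)
    show "subprob_space (K y)" for y
      unfolding K_def by (intro prob_space_imp_subprob_space prob_space.prob_space_distr prob_space_P measurable_X s)
    show "(\<lambda>y. emeasure (K y) B) \<in> borel_measurable borel" if "B \<in> sets borel" for B
      unfolding K_emeasure[OF that] using measurable_P[OF s that] by measurable
  qed (simp add: K_def)
  define N where "N = distr (P x) borel (X t)"
  have N: "prob_space N" unfolding N_def by (intro prob_space_distr measurable_X t)
  have KN: "K \<in> N \<rightarrow>\<^sub>M subprob_algebra borel" using K by (simp add: N_def)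
  have law: "distr (P x) borel (X (t + s)) = N \<bind> K"
  proof (rule measure_eqI)
    show "sets (distr (P x) borel (X (t + s))) = sets (N \<bind> K)"
      by (subst sets_bind[of N K borel]) (auto simp: N_def K_def)
    fix B :: "'e set" assume "B \<in> sets (distr (P x) borel (X (t + s)))"
    then have B: "B \<in> sets borel" by simp
    define A where "A = {w \<in> space M. X (t + s) w \<in> B}"
    have A: "A \<in> sets (P x)"
      using measurable_sets[OF measurable_X[of "t + s" x] B] s t
      by (simp add: A_def vimage_def Int_def space_P conj_commute)
    interpret finite_measure_subalgebra "P x" "F t"
    proof
      show "subalgebra (P x) (F t)"
        using filtration(1)[OF t] sets_P space_P by (simp add: subalgebra_def)
    qed
    define \<kappa> where "\<kappa> y = measure (P y) {w' \<in> space M. X s w' \<in> B}" for y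
    have \<kappa> [measurable]: "\<kappa> \<in> borel_measurable borel" unfolding \<kappa>_def by (rule measurable_P[OF s B])
    have \<kappa>X: "(\<lambda>w. \<kappa> (X t w)) \<in> borel_measurable (P x)"
      by (rule measurable_compose[OF measurable_X[OF t] \<kappa>])
    have \<kappa>_le: "0 \<le> \<kappa> y" "\<kappa> y \<le> 1" for y
      unfolding \<kappa>_def using prob_space.prob_le_1[OF prob_space_P] by auto
    have iA: "integrable (P x) (indicator A :: _ \<Rightarrow> real)" using A by (simp add: less_top[symmetric])
    have "emeasure (N \<bind> K) B = (\<integral>\<^sup>+y. emeasure (K y) B \<partial>N)"
      by (rule emeasure_bind[OF _ KN B]) (simp add: N_def)
    also have "\<dots> = (\<integral>\<^sup>+w. ennreal (\<kappa> (X t w)) \<partial>P x)"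
      unfolding N_def K_emeasure[OF B] \<kappa>_def[symmetric] using measurable_X[OF t] by (subst nn_integral_distr) auto
    also have "\<dots> = ennreal (\<integral>w. \<kappa> (X t w) \<partial>P x)"
      using \<kappa>_le \<kappa>X by (intro nn_integral_eq_integral integrable_const_bound[of _ 1]) auto
    also have "(\<integral>w. \<kappa> (X t w) \<partial>P x) = (\<integral>w. real_cond_exp (P x) (F t) (indicator A) w \<partial>P x)"
      using markov[OF s t B, of x] \<kappa>X unfolding A_def \<kappa>_def by (intro integral_cong_AE) (auto elim!: eventually_mono)
    also have "\<dots> = (\<integral>w. indicator A w \<partial>P x)" by (rule real_cond_exp_int(2)[OF iA])
    also have "\<dots> = measure (P x) A" using sets.sets_into_space[OF A] by (simp add: Int_absorb2)
    also have "ennreal \<dots> = emeasure (distr (P x) borel (X (t + s))) B"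
      using B measurable_X[of "t + s"] s t
      by (simp add: emeasure_distr emeasure_eq_measure A_def vimage_def Int_def space_P conj_commute)
    finally show "emeasure (distr (P x) borel (X (t + s))) B = emeasure (N \<bind> K) B" by simp
  qed
  have "transition X P (t + s) g x = (\<integral>y. g y \<partial>distr (P x) borel (X (t + s)))"
    unfolding transition_def using s t by (subst integral_distr) (auto intro: measurable_bcontfun)
  also have "\<dots> = (\<integral>y. (\<integral>z. g z \<partial>K y) \<partial>N)"
    unfolding law using N by (intro integral_bind_bcontfun KN) (auto simp: prob_space.not_empty prob_space_def)
  also have "\<dots> = (\<integral>y. transition X P s g y \<partial>N)"
    unfolding K_def transition_def using s by (subst integral_distr) (auto intro: measurable_bcontfun)
  also have "\<dots> = transition X P t (transition X P s g) x"
  proof -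
    have "(\<lambda>y. \<integral>z. g z \<partial>K y) \<in> borel_measurable borel"
      by (rule measurable_compose[OF K]) (use measurable_bcontfun[of g] in measurable)
    moreover have "(\<integral>z. g z \<partial>K y) = transition X P s g y" for y
      unfolding K_def transition_def using s by (subst integral_distr) (auto intro: measurable_bcontfun)
    ultimately have "transition X P s g \<in> borel_measurable borel" by simp
    then show ?thesis
      unfolding N_def transition_def[of X P t] using t by (subst integral_distr) auto
  qed
  finally show ?thesis .
qed

lemma transition_zero:
  fixes g :: "'e \<Rightarrow>\<^sub>C 'k::{banach, second_countable_topology}"
  shows "transition X P 0 g x = g x"
proof -
  interpret prob_space "P x" by (rule prob_space_P)
  have "{w \<in> space (P x). X 0 w = x} \<in> sets (P x)"
    using measurable_sets[OF measurable_X[of 0 x], of "{x}"] by (simp add: vimage_def Int_def conj_commute)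
  then have "AE w in P x. X 0 w = x"
    using normal[of x] prob_Collect_eq_1[of "\<lambda>w. X 0 w = x"] by (simp add: space_P)
  then have "(\<integral>w. g (X 0 w) \<partial>P x) = (\<integral>w. g x \<partial>P x)"
    by (intro integral_cong_AE) (auto intro: measurable_compose[OF measurable_X measurable_bcontfun])
  then show ?thesis by (simp add: transition_def prob_space)
qed

text \<open>Equality of path laws, read at the coordinate \<open>t\<close>, replaces the family
  \<open>P x\<close> by the single measure \<open>M\<close>, on which continuity in the starting
  point can be exploited.\<close>

lemma transition_started_process:
  fixes g :: "'e \<Rightarrow>\<^sub>C 'k::{banach, second_countable_topology}"
  assumes Y: "started_process M X P Y" and t: "0 \<le> t"
  shows "transition X P t g x = (\<integral>w. g (Y t x w) \<partial>M)"
proof -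
  have mY: "(\<lambda>w. Y s x w) \<in> borel_measurable M" if "0 \<le> s" for s
    using Y L0_measurable that unfolding started_process_def by blast
  have pY: "(\<lambda>w. \<lambda>t\<in>{0..}. Y t x w) \<in> M \<rightarrow>\<^sub>M PiM {0..} (\<lambda>_. borel)"
    by (rule measurable_restrict) (simp add: mY)
  have pX: "(\<lambda>w. \<lambda>t\<in>{0..}. X t w) \<in> P x \<rightarrow>\<^sub>M PiM {0..} (\<lambda>_. borel)"
    by (rule measurable_restrict) simp
  have ev: "(\<lambda>\<omega>. g (\<omega> t)) \<in> borel_measurable (PiM {0..} (\<lambda>_. borel))"
    by (rule measurable_compose[where f="\<lambda>\<omega>. \<omega> t" and N=borel]) (use t measurable_bcontfun in auto)
  have "(\<integral>w. g (Y t x w) \<partial>M) = (\<integral>\<omega>. g (\<omega> t) \<partial>distr M (PiM {0..} (\<lambda>_. borel)) (\<lambda>w. \<lambda>t\<in>{0..}. Y t x w))"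
    using t by (subst integral_distr[OF pY ev]) simp
  also have "\<dots> = (\<integral>\<omega>. g (\<omega> t) \<partial>distr (P x) (PiM {0..} (\<lambda>_. borel)) (\<lambda>w. \<lambda>t\<in>{0..}. X t w))"
    using Y unfolding started_process_def by simp
  also have "\<dots> = transition X P t g x"
    using t by (subst integral_distr[OF pX ev]) (simp add: transition_def)
  finally show ?thesis by simp
qed

lemma continuous_on_transition:
  fixes g :: "'e \<Rightarrow>\<^sub>C 'k::{banach, second_countable_topology}"
  assumes Y: "started_process M X P Y"
    and cont: "continuous_map (top_of_set ({0..} \<times> UNIV)) (L0_topology M) (\<lambda>(t, x). Y t x)"
  shows "continuous_on ({0..} \<times> UNIV) (\<lambda>(t, x). transition X P t g x)"
proof -
  have "(\<lambda>n. transition X P (fst (z n)) g (snd (z n))) \<longlonglongrightarrow> transition X P (fst a) g (snd a)"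
    if a: "a \<in> {0..} \<times> UNIV" and z: "\<forall>n. z n \<in> {0..} \<times> UNIV" "z \<longlonglongrightarrow> a" for a z
  proof -
    have M: "finite_measure M" using prob_space_M by (simp add: prob_space_def)
    have "limitin (top_of_set ({0..} \<times> UNIV)) z a sequentially"
      using a z by (simp add: limitin_subtopology)
    from continuous_map_limit[OF cont this]
    have "limitin (L0_topology M) (\<lambda>n. Y (fst (z n)) (snd (z n))) (Y (fst a) (snd a)) sequentially"
      by (simp add: o_def case_prod_beta)
    moreover have "Y (fst (z n)) (snd (z n)) \<in> L0 M" for n
      using Y z(1) unfolding started_process_def by (auto simp: mem_Times_iff)
    ultimately have "(\<lambda>n. \<integral>w. g (Y (fst (z n)) (snd (z n)) w) \<partial>M) \<longlonglongrightarrow> (\<integral>w. g (Y (fst a) (snd a) w) \<partial>M)"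
      by (rule limitin_L0_integral[OF M])
    moreover have "fst a \<ge> 0" "fst (z n) \<ge> 0" for n using a z(1) by (auto simp: mem_Times_iff)
    ultimately show ?thesis by (simp add: transition_started_process[OF Y])
  qed
  then show ?thesis
    by (auto simp: continuous_on_sequentially o_def case_prod_beta)
qed

lemma Cb_contraction_semigroup:
  assumes feller: "Cb_feller (transition X P :: real \<Rightarrow> ('e \<Rightarrow> 'k) \<Rightarrow> 'e \<Rightarrow> 'k::{real_normed_field, euclidean_space})"
    and Y: "started_process M X P Y"
    and cont: "continuous_map (top_of_set ({0..} \<times> UNIV)) (L0_topology M) (\<lambda>(t, x). Y t x)"
  shows "Cb_contraction_semigroup (Cb_semigroup (transition X P) :: real \<Rightarrow> ('e \<Rightarrow>\<^sub>C 'k) \<Rightarrow> ('e \<Rightarrow>\<^sub>C 'k))"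
proof -
  define T :: "real \<Rightarrow> ('e \<Rightarrow>\<^sub>C 'k) \<Rightarrow> ('e \<Rightarrow>\<^sub>C 'k)" where "T = Cb_semigroup (transition X P)"
  have T: "apply_bcontfun (T t g) = transition X P t g" if "0 \<le> t" for t g
    unfolding T_def Cb_semigroup_def
    using feller that apply_bcontfun[of g] unfolding Cb_feller_def by (intro Bcontfun_inverse) blast
  interpret vs: vector_space "bc_scale :: 'k \<Rightarrow> ('e \<Rightarrow>\<^sub>C 'k) \<Rightarrow> _" by (rule vector_space_bc_scale)
  have add: "T t (g + h) = T t g + T t h" and scale: "T t (bc_scale c g) = bc_scale c (T t g)"
    if "0 \<le> t" for t g h c
    using that by (auto intro!: bcontfun_eqI simp: T transition_def integrable_bcontfun)
  have norm_le: "norm (T t g x) \<le> (\<integral>w. norm (g (X t w)) \<partial>P x)" if "0 \<le> t" for t g x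
    using that by (simp add: T transition_def)
  show ?thesis
    unfolding T_def[symmetric]
  proof
    show "operator_semigroup bc_scale T"
      unfolding operator_semigroup_def
    proof (intro conjI allI impI)
      show "Vector_Spaces.linear bc_scale bc_scale (T t)" if "0 \<le> t" for t
        by unfold_locales (use that in \<open>auto simp: add scale\<close>)
      show "T 0 g = g" for g
        by (rule bcontfun_eqI) (simp add: T transition_zero)
      show "T (s + t) g = T s (T t g)" if "0 \<le> s" "0 \<le> t" for s t g
        using that Chapman_Kolmogorov[OF that(2,1), of g] by (intro bcontfun_eqI) (simp add: T)
    qed
    show "norm (T t g) \<le> norm g" if "0 \<le> t" for t g
    proof (rule norm_bound)
      fix x
      interpret prob_space "P x" by (rule prob_space_P)
      have "(\<integral>w. norm (g (X t w)) \<partial>P x) \<le> (\<integral>w. norm g \<partial>P x)"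
        by (intro integral_mono integrable_norm integrable_bcontfun that integrable_const norm_bounded)
      then show "norm (T t g x) \<le> norm g"
        using norm_le[OF that, of g x] by (simp add: prob_space)
    qed
    show "continuous_on ({0..} \<times> UNIV) (\<lambda>(t, x). T t g x)" for g
      using continuous_on_transition[OF Y cont, of g] by (rule continuous_on_eq) (auto simp: T)
    \<comment> \<open>The functional integrates against a probability measure, so dominated
      convergence applies; monotonicity and nonnegativity of \<open>k\<close> bound all members by
      \<open>norm (k 0)\<close>.\<close>
    show "sigma_smooth (\<lambda>g. T t g x)" if t: "0 \<le> t" for t x
      unfolding sigma_smooth_def
    proof (intro conjI exI[of _ "1::real"] allI impI)
      show "Vector_Spaces.linear bc_scale (*) (\<lambda>g. T t g x)"
        by unfold_locales (use t in \<open>auto simp: add scale algebra_simps\<close>)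
      show "norm (T t g x) \<le> 1 * norm g" for g
        using norm_bounded[of "T t g" x] \<open>\<And>t g. 0 \<le> t \<Longrightarrow> norm (T t g) \<le> norm g\<close>[OF t, of g] by simp
      fix k :: "nat \<Rightarrow> 'e \<Rightarrow>\<^sub>C real" and \<epsilon> :: real
      assume k: "\<forall>x. decseq (\<lambda>n. k n x) \<and> (\<lambda>n. k n x) \<longlonglongrightarrow> 0" and \<epsilon>: "\<epsilon> > 0"
      interpret prob_space "P x" by (rule prob_space_P)
      have k0: "0 \<le> k n y" for n y using k decseq_ge by blast
      have "(\<lambda>n. \<integral>w. k n (X t w) \<partial>P x) \<longlonglongrightarrow> (\<integral>w. 0 \<partial>P x)"
      proof (rule integral_dominated_convergence[where w="\<lambda>_. norm (k 0)"])
        show "AE w in P x. norm (k n (X t w)) \<le> norm (k 0)" for n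
        proof (rule AE_I2)
          fix w
          have "k n (X t w) \<le> k 0 (X t w)" using k by (simp add: decseq_def)
          then show "norm (k n (X t w)) \<le> norm (k 0)"
            using k0[of n "X t w"] norm_bounded[of "k 0" "X t w"] by simp
        qed
      qed (use k t in \<open>auto intro: measurable_compose[OF measurable_X measurable_bcontfun]\<close>)
      then have "\<forall>\<^sub>F n in sequentially. (\<integral>w. k n (X t w) \<partial>P x) < \<epsilon>"
        using \<epsilon> by (intro order_tendstoD(2)) simp_all
      then obtain n where n: "(\<integral>w. k n (X t w) \<partial>P x) < \<epsilon>"
        by (auto simp: eventually_sequentially)
      have "norm (T t h x) \<le> \<epsilon>" if "\<forall>x. norm (apply_bcontfun h x) \<le> k n x" for h
      proof -
        have "(\<integral>w. norm (h (X t w)) \<partial>P x) \<le> (\<integral>w. k n (X t w) \<partial>P x)"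
          using that by (intro integral_mono integrable_norm integrable_bcontfun t) auto
        then show ?thesis using norm_le[OF t, of h x] n by linarith
      qed
      then show "\<exists>n. \<forall>h. (\<forall>x. norm (apply_bcontfun h x) \<le> k n x) \<longrightarrow> norm (T t h x) \<le> \<epsilon>" by blast
    qed
  qed
qed

end

lemma op_neg_op_neg [simp]: "op_neg (op_neg A) = A"
  unfolding op_neg_def by force

theorem theorem5p24:
  fixes M :: "'w measure" and F :: "real \<Rightarrow> 'w measure"
    and X :: "real \<Rightarrow> 'w \<Rightarrow> 'e::complete_space" and P :: "'e \<Rightarrow> 'w measure"
    and T :: "real \<Rightarrow> ('e \<Rightarrow>\<^sub>C 'k::{real_normed_field, euclidean_space}) \<Rightarrow> ('e \<Rightarrow>\<^sub>C 'k)"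
    and Y :: "real \<Rightarrow> 'e \<Rightarrow> 'w \<Rightarrow> 'e"
    and f :: "real \<Rightarrow> real" and \<mu> :: "real \<Rightarrow> real measure"
  assumes "normal_markov_process M F X P"
    and "Cb_feller (transition X P :: real \<Rightarrow> ('e \<Rightarrow> 'k) \<Rightarrow> 'e \<Rightarrow> 'k)"
    and "T = Cb_semigroup (transition X P)"
    and "started_process M X P Y"
    and "continuous_map (top_of_set ({0..} \<times> UNIV)) (L0_topology M) (\<lambda>(t, x). Y t x)"
    and "bernstein_function f" and "bernstein_measures f \<mu>"
  shows "(\<forall>t\<ge>0. \<forall>g. \<exists>!h. has_pettis_integral bc_scale strict_topology (\<mu> t) {0..} (\<lambda>s. T s g) h) \<and>
    operator_semigroup bc_scale (subordinate bc_scale strict_topology \<mu> T) \<and>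
    generator strict_topology (subordinate bc_scale strict_topology \<mu> T)
      = op_neg (bernstein_op bc_scale strict_topology \<mu> T)"
proof -
  interpret normal_markov_process M F X P by fact
  interpret Cb_contraction_semigroup T
    unfolding assms(3) by (rule Cb_contraction_semigroup) fact+
  have \<mu>: "sets (\<mu> t) = sets borel" "emeasure (\<mu> t) {..<0} = 0" "finite_measure (\<mu> t)" if "0 \<le> t" for t
  proof -
    show *: "sets (\<mu> t) = sets borel" "emeasure (\<mu> t) {..<0} = 0"
      using assms(7) that unfolding bernstein_measures_def by blast+
    \<comment> \<open>The mass bound refers to \<open>{0..}\<close>, so the total mass is obtained
      by splitting the line at 0.\<close>
    have "space (\<mu> t) = {..<0} \<union> {0..}"
      using sets_eq_imp_space_eq[OF *(1)] by auto
    then have "emeasure (\<mu> t) (space (\<mu> t)) \<le> emeasure (\<mu> t) {..<0} + emeasure (\<mu> t) {0..}"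
      by (simp add: emeasure_subadditive *(1))
    also have "\<dots> \<le> 1"
      using assms(7) that unfolding bernstein_measures_def by (simp add: *(2))
    finally show "finite_measure (\<mu> t)"
      by (intro finite_measureI) (auto simp: top_unique)
  qed
  have zero: "\<mu> 0 = return borel 0"
    using assms(7) unfolding bernstein_measures_def by blast
  have conv: "(\<mu> s \<star> \<mu> t) = \<mu> (s + t)" if "0 \<le> s" "0 \<le> t" for s t
    using assms(7) that unfolding bernstein_measures_def by blast+
  have "operator_semigroup bc_scale (subordinate bc_scale strict_topology \<mu> T)"
    by (rule subordinate_semigroup) (use \<mu> zero conv in auto)
  moreover have "\<exists>!h. has_pettis_integral bc_scale strict_topology (\<mu> t) {0..} (\<lambda>s. T s g) h" if "0 \<le> t" for t g
    by (simp add: has_pettis_integral_iff_mean \<mu> that)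
  ultimately show ?thesis
    by (simp add: bernstein_op_def)
qed

end
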